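(* Let $k\ge 1$ be an integer and let $G$ be a finite simple graph that is claw-free and minimal $k$-factor-critical. Then the minimum degree of $G$ satisfies $\delta(G)=k+1$.
   Context: A graph $G$ of order $n$ is $k$-factor-critical (for an integer $1\le k<n$) if for every set $X$ of $k$ vertices, $G-X$ has a perfect matching. A $k$-factor-critical graph $G$ is minimal if for every edge $e$ of $G$, the graph $G-e$ is not $k$-factor-critical. A graph is claw-free if it has no induced subgraph isomorphic to $K_{1,3}$. $\delta(G)$ denotes the minimum vertex degree of $G$. *)

theory Defs
  imports Main
begin

type_synonym 'a ugraph = "'a set \<times> 'a set set"

abbreviation verts :: "'a ugraph \<Rightarrow> 'a set" where
  "verts G \<equiv> fst G"

abbreviation edges :: "'a ugraph \<Rightarrow> 'a set set" where
  "edges G \<equiv> snd G"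

definition finite_simple_graph :: "'a ugraph \<Rightarrow> bool" where
  "finite_simple_graph G \<longleftrightarrow>
     finite (verts G) \<and> (\<forall>e\<in>edges G. e \<subseteq> verts G \<and> card e = 2)"

definition induced_subgraph :: "'a ugraph \<Rightarrow> 'a set \<Rightarrow> 'a ugraph" where
  "induced_subgraph G S = (S, {e \<in> edges G. e \<subseteq> S})"

definition delete_vertices :: "'a ugraph \<Rightarrow> 'a set \<Rightarrow> 'a ugraph" where
  "delete_vertices G X = induced_subgraph G (verts G - X)"

definition delete_edge :: "'a ugraph \<Rightarrow> 'a set \<Rightarrow> 'a ugraph" where
  "delete_edge G e = (verts G, edges G - {e})"

definition degree :: "'a ugraph \<Rightarrow> 'a \<Rightarrow> nat" where
  "degree G v = card {e \<in> edges G. v \<in> e}"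

text \<open>Only meaningful for graphs with a finite, nonempty vertex set.\<close>
definition min_degree :: "'a ugraph \<Rightarrow> nat" where
  "min_degree G = Min (degree G ` verts G)"

definition perfect_matching :: "'a ugraph \<Rightarrow> 'a set set \<Rightarrow> bool" where
  "perfect_matching G M \<longleftrightarrow>
     M \<subseteq> edges G \<and> (\<forall>v\<in>verts G. \<exists>!e. e \<in> M \<and> v \<in> e)"

definition factor_critical :: "nat \<Rightarrow> 'a ugraph \<Rightarrow> bool" where
  "factor_critical k G \<longleftrightarrow>
     1 \<le> k \<and> k < card (verts G) \<and>
     (\<forall>X. X \<subseteq> verts G \<and> card X = k \<longrightarrow> (\<exists>M. perfect_matching (delete_vertices G X) M))"

definition minimal_factor_critical :: "nat \<Rightarrow> 'a ugraph \<Rightarrow> bool" where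
  "minimal_factor_critical k G \<longleftrightarrow>
     factor_critical k G \<and> (\<forall>e\<in>edges G. \<not> factor_critical k (delete_edge G e))"

definition graph_iso :: "'a ugraph \<Rightarrow> 'b ugraph \<Rightarrow> bool" where
  "graph_iso G H \<longleftrightarrow>
     (\<exists>f. bij_betw f (verts G) (verts H) \<and>
          (\<forall>u\<in>verts G. \<forall>v\<in>verts G. {u, v} \<in> edges G \<longleftrightarrow> {f u, f v} \<in> edges H))"

definition K13 :: "nat ugraph" where
  "K13 = ({0, 1, 2, 3}, {{0, 1}, {0, 2}, {0, 3}})"

definition claw_free :: "'a ugraph \<Rightarrow> bool" where
  "claw_free G \<longleftrightarrow> \<not> (\<exists>S. S \<subseteq> verts G \<and> graph_iso (induced_subgraph G S) K13)"

end

theory Submission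
  imports Defs
begin

text \<open>
  Suppose that all degrees are at least k + 2. For a critical edge uv, Sumner's theorem (a claw-free
  graph whose components are all even has a perfect matching) and a refinement of it for a
  claw-free graph minus one edge leave two possibilities. Either there is a mixed cut: k vertices
  together with the edge uv separate the graph into two odd sides. Or there is a twin cut: a set W
  of k + 1 common neighbours of u and v separates the odd parts containing u and v from an odd rest;
  then every edge uw with w in W is critical of the first kind. Take a mixed cut with a smallest
  side C, at the edge uv with u in C. There is a neighbour a of u in C such that ua has a mixed cut
  as well, and uncrossing the two cuts contradicts parity or the minimality of C: by claw-freeness
  the neighbours of u in C form a clique, so apart from a they lie in the vertex part of the second
  cut.
\<close>

text \<open>The obstacle is that deleting \<open>uv\<close> may create claws centred at common
  neighbours of \<open>u\<close> and \<open>v\<close>, so Sumner's theorem does not apply to the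
  graph without \<open>uv\<close>. In the refinement such a common neighbour \<open>w\<close> cuts
  off an odd piece. Factor-criticality is used mainly through one bound: a nonempty set that leaves
  a vertex outside itself and its boundary has at least \<open>k\<close> boundary vertices, and at
  least \<open>k + 1\<close> if it is odd. The degree bound \<open>k + 2\<close> is needed in full
  at two places: \<open>u\<close> must have a neighbour on its own side \<open>C\<close>, as
  \<open>X\<close> and \<open>v\<close> supply only \<open>k + 1\<close> neighbours; and in the
  uncrossing, when the corner shared by the two sides shrinks to \<open>u\<close>.\<close>

section \<open>Perfect matchings of vertex sets\<close>

text \<open>Records only the vertex set that is matched, not the matching, so that parity, unions
  and monotonicity become plain inductions. The relation is a parameter because it is also
  instantiated with a graph that lacks one edge.\<close>

inductive pm :: "('a \<Rightarrow> 'a \<Rightarrow> bool) \<Rightarrow> 'a set \<Rightarrow> bool" for r where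
  empty: "pm r {}"
| insert: "pm r S \<Longrightarrow> x \<notin> S \<Longrightarrow> y \<notin> S \<Longrightarrow> x \<noteq> y \<Longrightarrow> r x y \<Longrightarrow> pm r (insert x (insert y S))"

text \<open>\<open>isolated_in r S T\<close>: \<open>T\<close> is a union of connected components of the subgraph induced on \<open>S\<close>.\<close>
definition isolated_in :: "('a \<Rightarrow> 'a \<Rightarrow> bool) \<Rightarrow> 'a set \<Rightarrow> 'a set \<Rightarrow> bool" where
  "isolated_in r S T \<longleftrightarrow> T \<subseteq> S \<and> (\<forall>x\<in>T. \<forall>y\<in>S - T. \<not> r x y)"

lemma pm_finite: "pm r S \<Longrightarrow> finite S"
  by (induction rule: pm.induct) auto

lemma pm_even_card: "pm r S \<Longrightarrow> even (card S)"
proof (induction rule: pm.induct)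
  case (insert S x y)
  then show ?case using pm_finite[OF insert.hyps(1)] by simp
qed simp

lemma pm_Un: "pm r S \<Longrightarrow> pm r T \<Longrightarrow> S \<inter> T = {} \<Longrightarrow> pm r (S \<union> T)"
proof (induction rule: pm.induct)
  case (insert S x y)
  then have "pm r (insert x (insert y (S \<union> T)))"
    by (intro pm.insert) auto
  then show ?case by simp
qed simp

lemma pm_mono: "pm r S \<Longrightarrow> (\<And>x y. x \<in> S \<Longrightarrow> y \<in> S \<Longrightarrow> r x y \<Longrightarrow> r' x y) \<Longrightarrow> pm r' S"
proof (induction rule: pm.induct)
  case (insert S x y)
  then show ?case by (intro pm.insert) auto
qed (rule pm.empty)

text \<open>Every matched pair lies entirely inside or entirely outside \<open>T\<close>.\<close>

lemma pm_isolated_even: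
  assumes "pm r S" and "\<And>x y. r x y \<Longrightarrow> r y x" and "isolated_in r S T"
  shows "even (card T)"
  using assms(1,3)
proof (induction arbitrary: T rule: pm.induct)
  case empty
  then show ?case by (simp add: isolated_in_def)
next
  case (insert S x y)
  have fin: "finite T"
    using insert.prems pm_finite[OF insert.hyps(1)] finite_subset[of T "insert x (insert y S)"]
    by (auto simp: isolated_in_def)
  have "r y x" using assms(2) insert.hyps(5) .
  then have xy: "x \<in> T \<longleftrightarrow> y \<in> T"
    using insert.prems insert.hyps(5) unfolding isolated_in_def by blast
  have "isolated_in r S (T - {x, y})"
    using insert.prems insert.hyps(2,3) unfolding isolated_in_def by blast
  then have ev: "even (card (T - {x, y}))" by (rule insert.IH)
  show ?case
  proof (cases "x \<in> T")
    case True
    then have "card T = card (T - {x, y}) + card {x, y}"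
      using xy fin by (subst card_Diff_subset) (auto intro: card_mono simp: card_mono)
    then show ?thesis using ev insert.hyps(4) by simp
  next
    case False
    then show ?thesis using ev xy by simp
  qed
qed

lemma pm_imp_matching:
  assumes "pm (\<lambda>x y. {x, y} \<in> E) S"
  shows "\<exists>M \<subseteq> {e \<in> E. e \<subseteq> S}. \<forall>v\<in>S. \<exists>!e. e \<in> M \<and> v \<in> e"
  using assms
proof (induction rule: pm.induct)
  case (insert S x y)
  then obtain M where M: "M \<subseteq> {e \<in> E. e \<subseteq> S}" "\<forall>v\<in>S. \<exists>!e. e \<in> M \<and> v \<in> e" by blast
  have "\<exists>!e. e \<in> insert {x, y} M \<and> v \<in> e" if "v \<in> insert x (insert y S)" for v
  proof (cases "v \<in> S")
    case True
    then obtain e where e: "e \<in> M" "v \<in> e" and uniq: "\<And>e'. e' \<in> M \<Longrightarrow> v \<in> e' \<Longrightarrow> e' = e"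
      using M(2) by blast
    have "v \<notin> {x, y}" using True insert.hyps by auto
    then show ?thesis using e uniq by blast
  next
    case False
    then have "v \<in> {x, y}" "\<And>e. e \<in> M \<Longrightarrow> v \<notin> e" using that M(1) by auto
    then show ?thesis by blast
  qed
  moreover have "insert {x, y} M \<subseteq> {e \<in> E. e \<subseteq> insert x (insert y S)}"
    using M(1) insert.hyps by auto
  ultimately show ?case by (intro exI[of _ "insert {x, y} M"] conjI ballI)
qed (auto intro: exI[of _ "{}"])

lemma matching_imp_pm:
  assumes "finite S" and "M \<subseteq> {e \<in> E. e \<subseteq> S}" and "\<forall>e\<in>E. card e = 2"
    and "\<forall>v\<in>S. \<exists>!e. e \<in> M \<and> v \<in> e"
  shows "pm (\<lambda>x y. {x, y} \<in> E) S"
  using assms(1,2,4)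
proof (induction "card S" arbitrary: S M rule: less_induct)
  case less
  show ?case
  proof (cases "S = {}")
    case True
    then show ?thesis by (simp add: pm.empty)
  next
    case False
    then obtain x where x: "x \<in> S" by blast
    then obtain e where e: "e \<in> M" "x \<in> e" using less.prems(3) by blast
    then have "card e = 2" using less.prems(2) assms(3) by auto
    then obtain y where y: "e = {x, y}" "x \<noteq> y"
      using e(2) by (auto simp: card_2_iff insert_commute)
    have yS: "y \<in> S" using e y less.prems(2) by auto
    have no: "x \<notin> m \<and> y \<notin> m" if "m \<in> M - {e}" for m
      using that e(1) y(1) less.prems(3)[rule_format, OF x] less.prems(3)[rule_format, OF yS] by blast
    have "pm (\<lambda>x y. {x, y} \<in> E) (S - {x, y})"
    proof (rule less.hyps)
      show "card (S - {x, y}) < card S"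
        using less.prems(1) x by (intro psubset_card_mono) auto
      show "M - {e} \<subseteq> {e \<in> E. e \<subseteq> S - {x, y}}"
        using less.prems(2) no by auto
      show "\<forall>v\<in>S - {x, y}. \<exists>!ea. ea \<in> M - {e} \<and> v \<in> ea"
      proof
        fix v assume v: "v \<in> S - {x, y}"
        then obtain d where d: "d \<in> M" "v \<in> d" and uniq: "\<And>e'. e' \<in> M \<Longrightarrow> v \<in> e' \<Longrightarrow> e' = d"
          using less.prems(3) by blast
        have "v \<notin> e" using v y by simp
        then show "\<exists>!ea. ea \<in> M - {e} \<and> v \<in> ea"
          using d uniq by blast
      qed
    qed (use less.prems in simp)
    then have "pm (\<lambda>x y. {x, y} \<in> E) (insert x (insert y (S - {x, y})))"
      using e y less.prems(2) by (intro pm.insert) auto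
    moreover have "insert x (insert y (S - {x, y})) = S" using x yS by auto
    ultimately show ?thesis by simp
  qed
qed

section \<open>Claw-free relations\<close>

lemma card_split:
  assumes "finite S" "T \<subseteq> S"
  shows "card S = card T + card (S - T)"
  using assms by (metis card_Diff_subset card_mono finite_subset le_add_diff_inverse)

lemma odd_split:
  assumes "finite S" "T \<subseteq> S"
  shows "odd (card S) \<longleftrightarrow> odd (card T) \<noteq> odd (card (S - T))"
  using card_split[OF assms] by simp

lemma card_three_parts:
  assumes "finite S" "S \<subseteq> A \<union> B \<union> C" "A \<inter> B = {}" "A \<inter> C = {}" "B \<inter> C = {}"
  shows "card S = card (S \<inter> A) + card (S \<inter> B) + card (S \<inter> C)"
proof -
  have "card (S - S \<inter> A) = card (S \<inter> B) + card (S - S \<inter> A - S \<inter> B)"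
    using assms by (intro card_split) auto
  moreover have "S - S \<inter> A - S \<inter> B = S \<inter> C" using assms by blast
  ultimately show ?thesis using card_split[of S "S \<inter> A"] assms(1) by simp
qed

text \<open>Of \<open>m\<close> vertices to be deleted, \<open>i\<close> come from a set of size
  \<open>z\<close> and the others from a set of size \<open>w\<close>. The truncated difference
  \<open>m - w\<close> and its successor are both feasible values of \<open>i\<close>, and one of
  them leaves an odd remainder.\<close>

lemma split_budget:
  fixes z w m :: nat
  assumes "1 \<le> z" "1 \<le> w" "1 \<le> m" "m + 1 \<le> z + w"
  shows "\<exists>i\<le>z. i \<le> m \<and> m - i \<le> w \<and> odd (z - i)"
proof (cases "odd (z - (m - w))")
  case True
  then show ?thesis using assms by (intro exI[of _ "m - w"]) auto
next
  case False
  moreover have "z - (m - w) = Suc (z - (m - w + 1))" using assms by linarith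
  ultimately have "odd (z - (m - w + 1))" by simp
  then show ?thesis using assms by (intro exI[of _ "m - w + 1"]) auto
qed

locale claw_free_rel =
  fixes adj :: "'a \<Rightarrow> 'a \<Rightarrow> bool"
  assumes sym: "adj x y \<Longrightarrow> adj y x"
    and irrefl: "\<not> adj x x"
    and claw: "adj c x \<Longrightarrow> adj c y \<Longrightarrow> adj c z \<Longrightarrow> x \<noteq> y \<Longrightarrow> x \<noteq> z \<Longrightarrow> y \<noteq> z
      \<Longrightarrow> adj x y \<or> adj x z \<or> adj y z"
begin

abbreviation iso :: "'a set \<Rightarrow> 'a set \<Rightarrow> bool" where
  "iso \<equiv> isolated_in adj"

lemma isoD: "iso S T \<Longrightarrow> x \<in> T \<Longrightarrow> adj x y \<Longrightarrow> y \<in> S \<Longrightarrow> y \<in> T"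
  unfolding isolated_in_def by blast

lemma isoI: "T \<subseteq> S \<Longrightarrow> (\<And>x y. x \<in> T \<Longrightarrow> adj x y \<Longrightarrow> y \<in> S \<Longrightarrow> y \<in> T) \<Longrightarrow> iso S T"
  unfolding isolated_in_def by blast

lemma iso_subset: "iso S T \<Longrightarrow> T \<subseteq> S"
  unfolding isolated_in_def by blast

lemma iso_compl: "iso S T \<Longrightarrow> iso S (S - T)"
  unfolding isolated_in_def using sym by blast

lemma iso_trans: "iso S T \<Longrightarrow> iso T U \<Longrightarrow> iso S U"
  unfolding isolated_in_def by blast

text \<open>An odd isolated set of least size is connected: if it split, one of its two parts would
  be a smaller odd isolated set.\<close>

lemma minimal_odd_isolated:
  assumes "finite S" and "iso S T0" and "odd (card T0)"
  obtains K where "iso S K" "odd (card K)"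
    and "\<And>T. iso K T \<Longrightarrow> T = {} \<or> T = K"
proof -
  let ?P = "\<lambda>K. iso S K \<and> odd (card K)"
  obtain K where K: "?P K" and min: "\<And>L. ?P L \<Longrightarrow> card K \<le> card L"
    using exists_least_iff[of "\<lambda>n. \<exists>K. ?P K \<and> card K = n"] assms(2,3)
    by (metis (mono_tags, lifting) not_le)
  have finK: "finite K" using K assms(1) iso_subset finite_subset by blast
  have "T = {} \<or> T = K" if T: "iso K T" for T
  proof (rule ccontr)
    assume ne: "\<not> (T = {} \<or> T = K)"
    have sub: "T \<subseteq> K" using T by (rule iso_subset)
    have "odd (card T) \<or> odd (card (K - T))"
      using odd_split[OF finK sub] K by blast
    moreover have "iso S T" "iso S (K - T)"
      using iso_trans K T iso_compl by blast+
    ultimately have "card K \<le> card T \<or> card K \<le> card (K - T)" using min by blast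
    moreover have "card T < card K" "card (K - T) < card K"
      using ne sub finK by (auto intro!: psubset_card_mono)
    ultimately show False by simp
  qed
  then show thesis using that K by blast
qed

text \<open>
  \<open>B\<close> is empty (for Sumner's theorem) or consists of the other end \<open>v\<close> of a deleted edge \<open>uv\<close>. An odd
  component \<open>K\<close> of \<open>P - {u}\<close> falls into two odd pieces when a neighbour of \<open>u\<close> is removed. Take such a
  piece \<open>F\<close>, cut off by \<open>w\<close>, as small as possible. If \<open>w\<close> had no neighbour in \<open>B\<close>, then all neighbours
  of \<open>w\<close> outside \<open>F\<close> would be such cut vertices themselves, and \<open>K\<close> would be partitioned into \<open>F\<close> with
  \<open>w\<close> and the analogous even pieces at these neighbours, contradicting that \<open>K\<close> is odd.
\<close>
lemma forced_cut_vertex: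
  assumes fin: "finite P" and u: "u \<in> P" and even: "even (card P)"
    and B: "B \<subseteq> {v}"
    and conn: "\<And>T. T \<subseteq> P - {u} \<Longrightarrow> T \<noteq> {} \<Longrightarrow>
        (\<exists>x\<in>T. \<exists>y\<in>P - T - {u}. adj x y) \<or> (\<exists>x\<in>T. adj u x \<and> x \<notin> B)"
    and odd: "\<And>w. w \<in> P \<Longrightarrow> adj u w \<Longrightarrow> w \<notin> B \<Longrightarrow>
        \<exists>T. iso (P - {u, w}) T \<and> odd (card T)"
  shows "\<exists>w D. w \<in> P \<and> adj u w \<and> w \<notin> B \<and> (\<exists>b\<in>B. adj w b) \<and> D \<subseteq> P - {u, w} \<and> D \<inter> B = {} \<and>
     odd (card D) \<and> (\<forall>x\<in>D. \<forall>y\<in>P. adj x y \<longrightarrow> y \<in> insert w D)"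
proof -
  have "odd (card (P - {u}))" 
    using even card_Suc_Diff1[OF fin u] by (metis even_Suc)
  moreover have "iso (P - {u}) (P - {u})" by (auto intro: isoI)
  ultimately obtain K where K: "iso (P - {u}) K" "odd (card K)"
    and Kc: "\<And>T. iso K T \<Longrightarrow> T = {} \<or> T = K"
    using minimal_odd_isolated[of "P - {u}"] fin by blast
  have KP: "K \<subseteq> P - {u}" using K(1) by (rule iso_subset)
  have finK: "finite K" using KP fin finite_subset by blast
  have Kne: "K \<noteq> {}" using K(2) by auto
  define Nu where "Nu = {w \<in> K. adj u w \<and> w \<notin> B}"
  have reach: "\<exists>x\<in>T. adj u x \<and> x \<notin> B" if "iso (P - {u}) T" "T \<noteq> {}" for T
    using conn[of T] that unfolding isolated_in_def by blast
  have split: "\<exists>T. iso (K - {w}) T \<and> odd (card T) \<and> odd (card (K - {w} - T))" if w: "w \<in> Nu" for w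
  proof -
    have wK: "w \<in> K" "adj u w" "w \<notin> B" "w \<in> P" using w KP unfolding Nu_def by auto
    obtain T where T: "iso (P - {u, w}) T" "odd (card T)" using odd[OF wK(4,2,3)] by blast
    have TP: "T \<subseteq> P - {u, w}" using T(1) by (rule iso_subset)
    have finT: "finite T" using TP fin finite_subset by blast
    let ?E = "P - {u} - K"
    have ev: "even (card ?E)"
      using odd_split[OF _ KP] fin K(2) \<open>odd (card (P - {u}))\<close> by simp
    \<comment> \<open>Outside \<open>K\<close> the set \<open>P - {u}\<close> is even, so an odd
      \<open>T - K\<close> would leave an odd rest there. Each of the two would contain a neighbour
      of \<open>u\<close>, and together with \<open>w\<close> these would be the leaves of a claw at
      \<open>u\<close>.\<close>
    have "\<not> odd (card (T - K))"
    proof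
      assume o1: "odd (card (T - K))"
      have sub: "T - K \<subseteq> ?E" using TP by blast
      have o2: "odd (card (?E - (T - K)))"
        using odd_split[OF _ sub] fin ev o1 by simp
      have i1: "iso (P - {u}) (T - K)"
        using T(1) K(1) wK(1) sym unfolding isolated_in_def by blast
      have i2: "iso (P - {u}) (?E - (T - K))"
        using T(1) K(1) wK(1) sym unfolding isolated_in_def by blast
      obtain x where x: "x \<in> T - K" "adj u x" using reach[OF i1] o1 by fastforce
      obtain y where y: "y \<in> ?E - (T - K)" "adj u y" using reach[OF i2] o2 by fastforce
      have "adj w x \<or> adj w y \<or> adj x y"
        using claw[OF wK(2) x(2) y(2)] x y wK(1) by blast
      then show False
        using isoD[OF K(1) wK(1)] isoD[OF i1 x(1)] x y TP by blast
    qed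
    moreover have "card T = card (T \<inter> K) + card (T - K)"
      using finT by (metis card_Int_Diff)
    ultimately have oT: "odd (card (T \<inter> K))" using T(2) by simp
    have iso: "iso (K - {w}) (T \<inter> K)"
      using T(1) KP unfolding isolated_in_def by blast
    have "even (card (K - {w}))" using K(2) wK(1) finK by simp
    then have "odd (card (K - {w} - (T \<inter> K)))"
      using odd_split[OF _ iso_subset[OF iso]] finK oT by simp
    then show ?thesis using iso oT by blast
  qed
  \<comment> \<open>Both pieces at a cut vertex are odd, so one can be chosen that avoids a given
    vertex: \<open>v\<close> at the start, \<open>w\<close> later.\<close>
  have away: "\<exists>T. iso (K - {w}) T \<and> odd (card T) \<and> z \<notin> T" if w: "w \<in> Nu" for w z
  proof -
    obtain T where T: "iso (K - {w}) T" "odd (card T)" "odd (card (K - {w} - T))"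
      using split[OF w] by blast
    show ?thesis using T iso_compl[OF T(1)] by (cases "z \<in> T") blast+
  qed
  \<comment> \<open>Since \<open>K\<close> is connected, a part of it that is closed under adjacency
    and misses a vertex is empty. The pieces at different cut vertices are compared in this
    way.\<close>
  have trivial: "T = {}" if "T \<subseteq> K" "z \<in> K" "z \<notin> T" "\<And>x y. x \<in> T \<Longrightarrow> adj x y \<Longrightarrow> y \<in> K \<Longrightarrow> y \<in> T" for T z
    using Kc[OF isoI[of T K]] that by blast
  define good where "good = (\<lambda>w F. w \<in> Nu \<and> iso (K - {w}) F \<and> odd (card F) \<and> F \<inter> B = {})"
  obtain w0 where "w0 \<in> Nu" using reach[OF K(1) Kne] unfolding Nu_def by blast
  then obtain F0 where "good w0 F0" using away[of w0 v] B unfolding good_def by blast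
  then obtain w F where good: "good w F" and min: "\<And>w' F'. good w' F' \<Longrightarrow> card F \<le> card F'"
    using exists_least_iff[of "\<lambda>n. \<exists>w F. good w F \<and> card F = n"]
    by (metis (mono_tags, lifting) not_le)
  have w: "w \<in> Nu" "w \<in> K" "adj u w" "w \<notin> B" using good unfolding good_def Nu_def by auto
  have F: "iso (K - {w}) F" "odd (card F)" "F \<inter> B = {}" using good unfolding good_def by auto
  have FK: "F \<subseteq> K - {w}" using F(1) by (rule iso_subset)
  have finF: "finite F" using FK finK finite_subset by blast
  have Fout: "y \<in> insert w F" if "x \<in> F" "adj x y" "y \<in> K" for x y
    using isoD[OF F(1) that(1,2)] that by blast
  \<comment> \<open>A neighbour \<open>q\<close> of \<open>u\<close> in \<open>F\<close> would be a
    cut vertex of \<open>K\<close> too, and its odd piece avoiding \<open>w\<close> would be a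
    proper subset of \<open>F\<close>.\<close>
  have clean: "\<not> adj u q" if q: "q \<in> F" for q
  proof
    assume "adj u q"
    then have qN: "q \<in> Nu" using q FK F(3) unfolding Nu_def by blast
    obtain T where T: "iso (K - {q}) T" "odd (card T)" "w \<notin> T" using away[OF qN] by blast
    have TK: "T \<subseteq> K - {q}" using T(1) by (rule iso_subset)
    have "T - F = {}"
    proof (rule trivial[of _ w])
      fix x y assume x: "x \<in> T - F" and a: "adj x y" and y: "y \<in> K"
      have "y \<notin> F" using Fout[OF _ sym[OF a]] x TK T(3) by blast
      moreover have "y \<in> T" using isoD[OF T(1) _ a] x y q \<open>y \<notin> F\<close> by blast
      ultimately show "y \<in> T - F" by blast
    qed (use TK T w in auto)
    then have "T \<subset> F" using q TK by blast
    moreover have "good q T" using qN T F(3) \<open>T \<subset> F\<close> unfolding good_def by blast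
    ultimately show False using min[of q T] psubset_card_mono[OF finF, of T] by simp
  qed
  have "\<exists>b\<in>B. adj w b"
  proof (rule ccontr)
    assume nb: "\<not> (\<exists>b\<in>B. adj w b)"
    define Q where "Q = {q \<in> K - F. adj w q}"
    obtain f where f: "f \<in> F" "adj w f"
    proof -
      have "F \<noteq> {}" using F(2) by auto
      then have "\<exists>x\<in>F. adj x w" using trivial[of F w] Fout FK w(2) by (metis Diff_iff insert_iff subset_iff)
      then show thesis using that sym by blast
    qed
    \<comment> \<open>The neighbours \<open>u\<close>, \<open>f\<close> and \<open>q\<close> of
      \<open>w\<close> cannot form a claw, and \<open>f\<close> is adjacent neither to
      \<open>u\<close> nor to \<open>q\<close>.\<close>
    have uQ: "adj u q" if q: "q \<in> Q" for q
    proof -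
      have "adj u f \<or> adj u q \<or> adj f q"
        using claw[OF sym[OF w(3)] f(2), of q] q f(1) KP FK unfolding Q_def by blast
      then show ?thesis using clean f Fout q irrefl unfolding Q_def by blast
    qed
    have QN: "q \<in> Nu" if "q \<in> Q" for q
      using uQ[OF that] that nb unfolding Nu_def Q_def by blast
    have "\<forall>p\<in>Q. \<exists>T. iso (K - {p}) T \<and> odd (card T) \<and> w \<notin> T"
      using away QN by blast
    then obtain T where T: "\<And>p. p \<in> Q \<Longrightarrow> iso (K - {p}) (T p)"
        "\<And>p. p \<in> Q \<Longrightarrow> odd (card (T p))" "\<And>p. p \<in> Q \<Longrightarrow> w \<notin> T p"
      by metis
    have TK: "T p \<subseteq> K - {p}" if "p \<in> Q" for p using T(1)[OF that] by (rule iso_subset)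
    have Tout: "y \<in> insert p (T p)" if "p \<in> Q" "x \<in> T p" "adj x y" "y \<in> K" for p x y
      using isoD[OF T(1)[OF that(1)] that(2,3)] that(4) by blast
    have wQ: "w \<notin> Q" unfolding Q_def using irrefl by blast
    have TQ: "T p \<inter> Q = {}" if p: "p \<in> Q" for p
    proof -
      have "q \<notin> T p" if q: "q \<in> Q" for q
        using Tout[OF p, of q w] q p w(2) T(3)[OF p] wQ sym unfolding Q_def by blast
      then show ?thesis by blast
    qed
    have TF: "T p \<inter> F = {}" if p: "p \<in> Q" for p
    proof (rule trivial[of _ w])
      fix x y assume x: "x \<in> T p \<inter> F" and a: "adj x y" and y: "y \<in> K"
      have "p \<notin> F" "p \<noteq> w" using p wQ unfolding Q_def by auto
      moreover have "y \<in> insert w F" "y \<in> insert p (T p)"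
        using Fout[OF _ a y] Tout[OF p _ a y] x by blast+
      ultimately show "y \<in> T p \<inter> F" using T(3)[OF p] by blast
    qed (use w FK in auto)
    have TT: "T p \<inter> T p' = {}" if p: "p \<in> Q" "p' \<in> Q" "p \<noteq> p'" for p p'
    proof (rule trivial[of _ w])
      fix x y assume x: "x \<in> T p \<inter> T p'" and a: "adj x y" and y: "y \<in> K"
      have "y \<in> insert p (T p)" "y \<in> insert p' (T p')"
        using Tout[OF p(1) _ a y] Tout[OF p(2) _ a y] x by blast+
      then show "y \<in> T p \<inter> T p'" using TQ p by blast
    qed (use w TK p T(3) in auto)
    \<comment> \<open>Otherwise \<open>w\<close>, a vertex \<open>m\<close> of \<open>T p\<close>
      and \<open>y\<close> would be the leaves of a claw at \<open>p\<close>.\<close>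
    have Nq: "y \<in> insert w (Q \<union> T p)" if p: "p \<in> Q" and a: "adj p y" and y: "y \<in> K" for p y
    proof (rule ccontr)
      assume ny: "y \<notin> insert w (Q \<union> T p)"
      have "T p \<noteq> {}" using T(2)[OF p] by auto
      then have "\<exists>m\<in>T p. adj m p" using trivial[of "T p" p] Tout[OF p] TK[OF p] p unfolding Q_def by blast
      then obtain m where m: "m \<in> T p" "adj m p" by blast
      have "adj p w" using p sym unfolding Q_def by blast
      then have "adj w m \<or> adj w y \<or> adj m y"
        using claw[OF _ sym[OF m(2)] a, of w] m(1) ny T(3)[OF p] by blast
      moreover have "\<not> adj w m"
        using Tout[OF p m(1), of w] sym w(2) T(3)[OF p] wQ p by blast
      moreover have "\<not> adj m y" using Tout[OF p m(1) _ y] ny a irrefl by blast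
      moreover have "\<not> adj w y"
        using ny y Fout[OF _ sym[OF a]] p wQ unfolding Q_def by blast
      ultimately show False by blast
    qed
    \<comment> \<open>\<open>U\<close> is closed under adjacency in \<open>K\<close>, hence all of
      \<open>K\<close>; but each of its blocks is an odd piece plus one cut vertex, hence
      even.\<close>
    define U where "U = insert w F \<union> (\<Union>p\<in>Q. insert p (T p))"
    have "U = K"
    proof -
      have "iso K U"
      proof (rule isoI)
        show "U \<subseteq> K" using w FK TK unfolding U_def Q_def by blast
        fix x y assume x: "x \<in> U" and a: "adj x y" and y: "y \<in> K"
        consider "x = w" | "x \<in> F" | p where "p \<in> Q" "x = p" | p where "p \<in> Q" "x \<in> T p"
          using x unfolding U_def by blast
        then show "y \<in> U"
        proof cases
          case 1
          then show ?thesis using a y unfolding U_def Q_def by blast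
        next
          case 2
          then show ?thesis using Fout a y unfolding U_def by blast
        next
          case 3
          then show ?thesis using Nq a y unfolding U_def by blast
        next
          case 4
          then show ?thesis using Tout a y unfolding U_def by blast
        qed
      qed
      then show ?thesis using Kc unfolding U_def by blast
    qed
    have finQ: "finite Q" unfolding Q_def using finK by simp
    have finT: "finite (T p)" if "p \<in> Q" for p using TK[OF that] finK finite_subset by blast
    have "card (\<Union>p\<in>Q. insert p (T p)) = (\<Sum>p\<in>Q. card (insert p (T p)))"
      using finQ finT TQ TT by (intro card_UN_disjoint) auto
    moreover have "even (\<Sum>p\<in>Q. card (insert p (T p)))"
    proof (rule dvd_sum)
      fix p assume p: "p \<in> Q"
      have "p \<notin> T p" using TK[OF p] by blast
      then show "even (card (insert p (T p)))" using T(2)[OF p] finT[OF p] by simp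
    qed
    moreover have "insert w F \<inter> (\<Union>p\<in>Q. insert p (T p)) = {}"
      using wQ T(3) TF unfolding Q_def by blast
    then have "card U = card (insert w F) + card (\<Union>p\<in>Q. insert p (T p))"
      unfolding U_def using finF finQ finT by (intro card_Un_disjoint) auto
    moreover have "even (card (insert w F))" using F(2) finF FK by (simp add: subset_Diff_insert)
    ultimately show False using \<open>U = K\<close> K(2) by simp
  qed
  moreover have "y \<in> insert w F" if "x \<in> F" "adj x y" "y \<in> P" for x y
  proof -
    have "y \<noteq> u" using clean that sym by blast
    then have "y \<in> K" using isoD[OF K(1) _ that(2)] that FK by blast
    then show ?thesis using Fout that by blast
  qed
  ultimately show ?thesis using w F FK KP by (intro exI[of _ w] exI[of _ F]) blast
qed

text \<open>Sumner's theorem. If \<open>S\<close> is connected but has no perfect matching, then by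
  induction matching \<open>u\<close> to any neighbour leaves an odd isolated set. With
  \<open>B\<close> empty, \<open>forced_cut_vertex\<close> then yields a neighbour in the empty
  set.\<close>

lemma pm_if_isolated_even:
  assumes "finite S" and "\<And>T. iso S T \<Longrightarrow> even (card T)"
  shows "pm adj S"
  using assms
proof (induction "card S" arbitrary: S rule: less_induct)
  case less
  show ?case
  proof (cases "\<exists>T. iso S T \<and> T \<noteq> {} \<and> T \<noteq> S")
    case True
    then obtain T where T: "iso S T" "T \<noteq> {}" "T \<noteq> S" by blast
    have part: "pm adj U" if U: "iso S U" "U \<noteq> S" for U
    proof (rule less.hyps)
      have sub: "U \<subseteq> S" using U(1) by (rule iso_subset)
      then show "card U < card S" using U(2) less.prems(1) by (simp add: psubset_card_mono psubset_eq)
      show "finite U" using sub less.prems(1) finite_subset by blast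
      show "even (card V)" if "iso U V" for V using less.prems(2) iso_trans[OF U(1) that] .
    qed
    have "pm adj (T \<union> (S - T))"
      using part[OF T(1,3)] part[OF iso_compl[OF T(1)]] T iso_subset[OF T(1)]
      by (intro pm_Un) blast+
    then show ?thesis using iso_subset[OF T(1)] by (simp add: Un_absorb1)
  next
    case conn: False
    show ?thesis
    proof (rule ccontr)
      assume no: "\<not> pm adj S"
      then obtain u where u: "u \<in> S" using pm.empty by fastforce
      have "\<exists>T. iso (S - {u, w}) T \<and> odd (card T)" if w: "w \<in> S" "adj u w" for w
      proof (rule ccontr)
        assume "\<not> (\<exists>T. iso (S - {u, w}) T \<and> odd (card T))"
        moreover have "card (S - {u, w}) < card S"
          using u less.prems(1) by (intro psubset_card_mono) auto
        ultimately have "pm adj (S - {u, w})" using less.hyps less.prems(1) by blast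
        then have "pm adj (insert u (insert w (S - {u, w})))"
          using w irrefl by (intro pm.insert) auto
        moreover have "insert u (insert w (S - {u, w})) = S" using u w by blast
        ultimately show False using no by simp
      qed
      moreover have "(\<exists>x\<in>T. \<exists>y\<in>S - T - {u}. adj x y) \<or> (\<exists>x\<in>T. adj u x)"
        if "T \<subseteq> S - {u}" "T \<noteq> {}" for T
      proof (rule ccontr)
        assume a: "\<not> ?thesis"
        have "iso S T"
        proof (rule isoI)
          show "y \<in> T" if "x \<in> T" "adj x y" "y \<in> S" for x y
            using a that sym by blast
        qed (use that in blast)
        then show False using conn that u by blast
      qed
      moreover have "even (card S)" using less.prems(2)[OF isoI] by blast
      ultimately show False
        using forced_cut_vertex[of S u "{}" u] less.prems(1) u by auto
    qed
  qed
qed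

end

section \<open>Critical edges of factor-critical claw-free graphs\<close>

locale fc_graph = claw_free_rel +
  fixes V :: "'a set" and k :: nat
  assumes finV: "finite V"
    and adjV: "adj x y \<Longrightarrow> x \<in> V"
    and k1: "1 \<le> k" and kV: "k < card V"
    and fc: "X \<subseteq> V \<Longrightarrow> card X = k \<Longrightarrow> pm adj (V - X)"
begin

section \<open>Parity and lower bounds for boundaries\<close>

lemma adjV2: "adj x y \<Longrightarrow> y \<in> V"
  using adjV sym by blast

lemma parity: "odd (card V) \<longleftrightarrow> odd k"
proof -
  obtain X where X: "X \<subseteq> V" "card X = k" "finite X"
    using obtain_subset_with_card_n[of k V] kV by auto
  show ?thesis using pm_even_card[OF fc[OF X(1,2)]] odd_split[OF finV X(1)] X(2) by blast
qed

lemma fc_isolated_even: "X \<subseteq> V \<Longrightarrow> card X = k \<Longrightarrow> iso (V - X) T \<Longrightarrow> even (card T)"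
  using pm_isolated_even[OF fc] sym by blast

text \<open>If \<open>Y\<close> were smaller, it could be enlarged to a set of size \<open>k\<close> leaving an odd part of \<open>Z\<close>.\<close>
lemma boundary_ge:
  assumes Z: "Z \<subseteq> V" "Z \<noteq> {}" and Y: "Y \<subseteq> V" "Z \<inter> Y = {}" and z0: "z0 \<in> V" "z0 \<notin> Z" "z0 \<notin> Y"
    and nbr: "\<And>x y. x \<in> Z \<Longrightarrow> adj x y \<Longrightarrow> y \<in> Z \<union> Y"
  shows "k \<le> card Y" and "odd (card Z) \<Longrightarrow> k + 1 \<le> card Y"
proof -
  have fin: "finite Z" "finite Y" using Z Y finV finite_subset by blast+
  show ge: "k \<le> card Y"
  proof (rule ccontr)
    assume less: "\<not> k \<le> card Y"
    define W where "W = V - Y - Z"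
    have finW: "finite W" unfolding W_def using finV by simp
    have "card Y + card Z + card W = card V"
    proof -
      have "card (V - Y) = card Z + card W"
        unfolding W_def using finV Z Y by (intro card_split) auto
      then show ?thesis using card_split[OF finV Y(1)] by simp
    qed
    moreover have "1 \<le> card Z" "1 \<le> card W"
      using fin finW Z z0 unfolding W_def by (auto simp: Suc_le_eq card_gt_0_iff)
    \<comment> \<open>\<open>k - card Y\<close> further vertices are to be deleted from
      \<open>Z\<close> and \<open>W\<close> so that an odd part of \<open>Z\<close> remains;
      \<open>z0\<close> guarantees that \<open>W\<close> is not empty.\<close>
    ultimately have "\<exists>i\<le>card Z. i \<le> k - card Y \<and> k - card Y - i \<le> card W \<and> odd (card Z - i)"
      using kV less by (intro split_budget) auto
    then obtain i where i: "i \<le> card Z" "i \<le> k - card Y" "k - card Y - i \<le> card W" "odd (card Z - i)"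
      by blast
    obtain A where A: "A \<subseteq> Z" "card A = i" using obtain_subset_with_card_n[OF i(1)] by blast
    obtain B where B: "B \<subseteq> W" "card B = k - card Y - i" using obtain_subset_with_card_n[OF i(3)] by blast
    have finAB: "finite A" "finite B" using A B fin finW finite_subset by blast+
    have "card (Y \<union> (A \<union> B)) = card Y + (card A + card B)"
      using fin finAB A B Y(2) unfolding W_def
      by (subst card_Un_disjoint, (auto)[3], subst card_Un_disjoint) auto
    then have "card (Y \<union> (A \<union> B)) = k" using A B i less by simp
    moreover have "Y \<union> (A \<union> B) \<subseteq> V" using A B Y Z unfolding W_def by blast
    moreover have "iso (V - (Y \<union> (A \<union> B))) (Z - A)"
    proof (rule isoI)
      show "Z - A \<subseteq> V - (Y \<union> (A \<union> B))" using A B Y Z unfolding W_def by blast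
    qed (use nbr in blast)
    ultimately have "even (card (Z - A))" by (metis fc_isolated_even)
    then show False using A i(4) finAB by (simp add: card_Diff_subset)
  qed
  show "k + 1 \<le> card Y" if "odd (card Z)"
  proof (rule ccontr)
    assume "\<not> k + 1 \<le> card Y"
    then have "card Y = k" using ge by simp
    moreover have "iso (V - Y) Z"
    proof (rule isoI)
      show "Z \<subseteq> V - Y" using Y Z by blast
    qed (use nbr in blast)
    ultimately show False using fc_isolated_even[OF Y(1)] that by blast
  qed
qed

text \<open>If \<open>y\<close> had no neighbour in \<open>Z\<close>, then \<open>Y - {y}\<close>
  would be a boundary of at most \<open>k\<close> vertices for an odd set.\<close>

lemma odd_touches_all:
  assumes Z: "Z \<subseteq> V" "odd (card Z)" and Y: "Y \<subseteq> V" "Z \<inter> Y = {}" "card Y \<le> k + 1"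
    and z0: "z0 \<in> V" "z0 \<notin> Z" "z0 \<notin> Y"
    and nbr: "\<And>x y. x \<in> Z \<Longrightarrow> adj x y \<Longrightarrow> y \<in> Z \<union> Y" and y: "y \<in> Y"
  shows "\<exists>z\<in>Z. adj y z"
proof (rule ccontr)
  assume no: "\<not> (\<exists>z\<in>Z. adj y z)"
  have "Z \<noteq> {}" using Z by auto
  have "k + 1 \<le> card (Y - {y})"
  proof (rule boundary_ge(2)[OF Z(1) \<open>Z \<noteq> {}\<close> _ _ z0(1,2) _ _ Z(2)])
    show "y' \<in> Z \<union> (Y - {y})" if "x \<in> Z" "adj x y'" for x y'
      using nbr[OF that] no that sym by blast
  qed (use Y z0 in auto)
  moreover have "card (Y - {y}) < card Y"
    using y Y finV by (meson card_Diff1_less finite_subset)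
  ultimately show False using Y(3) by simp
qed

section \<open>Critical edges and the two kinds of cut\<close>

definition adj_del :: "'a \<Rightarrow> 'a \<Rightarrow> 'a \<Rightarrow> 'a \<Rightarrow> bool" where
  "adj_del u v x y \<longleftrightarrow> adj x y \<and> {x, y} \<noteq> {u, v}"

definition critical :: "'a \<Rightarrow> 'a \<Rightarrow> bool" where
  "critical u v \<longleftrightarrow> adj u v \<and> (\<exists>X\<subseteq>V. card X = k \<and> \<not> pm (adj_del u v) (V - X))"

text \<open>A certificate that \<open>uv\<close> is critical: after deletion of \<open>X\<close> the
  odd side \<open>C\<close> can be matched only by means of \<open>uv\<close>.\<close>

definition mixed_cut :: "'a \<Rightarrow> 'a \<Rightarrow> 'a set \<Rightarrow> 'a set \<Rightarrow> 'a set \<Rightarrow> bool" where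
  "mixed_cut u v X C D \<longleftrightarrow> X \<union> C \<union> D = V \<and> X \<inter> C = {} \<and> X \<inter> D = {} \<and> C \<inter> D = {} \<and>
     card X = k \<and> odd (card C) \<and> odd (card D) \<and> u \<in> C \<and> v \<in> D \<and> adj u v \<and>
     (\<forall>x\<in>C. \<forall>y\<in>D. adj x y \<longrightarrow> x = u \<and> y = v)"

text \<open>Deleting all but one vertex of \<open>W\<close> leaves a single vertex to serve three
  odd parts, so \<open>uv\<close> is critical. Each \<open>w\<close> in \<open>W\<close> has
  neighbours in all three parts; only the edge \<open>uv\<close> prevents a claw there.\<close>

definition twin_cut :: "'a \<Rightarrow> 'a \<Rightarrow> 'a set \<Rightarrow> 'a set \<Rightarrow> 'a set \<Rightarrow> 'a set \<Rightarrow> bool" where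
  "twin_cut u v W C D R \<longleftrightarrow> W \<union> C \<union> D \<union> R = V \<and> W \<inter> C = {} \<and> W \<inter> D = {} \<and> W \<inter> R = {} \<and>
     C \<inter> D = {} \<and> C \<inter> R = {} \<and> D \<inter> R = {} \<and> card W = k + 1 \<and>
     odd (card C) \<and> odd (card D) \<and> odd (card R) \<and> u \<in> C \<and> v \<in> D \<and> adj u v \<and>
     (\<forall>x\<in>C. \<forall>y\<in>D. adj x y \<longrightarrow> x = u \<and> y = v) \<and>
     (\<forall>x\<in>C \<union> D. \<forall>y\<in>R. \<not> adj x y) \<and>
     (\<forall>w\<in>W. adj w u \<and> adj w v \<and> (\<forall>x\<in>C. adj w x \<longrightarrow> x = u) \<and> (\<forall>x\<in>D. adj w x \<longrightarrow> x = v) \<and>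
        (\<exists>r\<in>R. adj w r))"

lemma mixed_cut_sym: "mixed_cut u v X C D \<Longrightarrow> mixed_cut v u X D C"
  unfolding mixed_cut_def using sym by blast

text \<open>The \<open>k\<close>-set \<open>X\<close> is any set between the vertices of
  \<open>Y\<close> that \<open>C\<close> really touches and \<open>Y\<close> itself. The other side
  is then everything else, and it is odd because \<open>V - X\<close> is even.\<close>

lemma mixed_cut_if_odd_side:
  assumes C: "C \<subseteq> V" "odd (card C)" "u \<in> C" and v: "adj u v" "v \<notin> C" "v \<notin> Y"
    and Y: "Y \<subseteq> V" "C \<inter> Y = {}" "k \<le> card Y"
    and nbr: "\<And>x y. x \<in> C \<Longrightarrow> adj x y \<Longrightarrow> y \<in> C \<union> Y \<or> x = u \<and> y = v"
    and small: "card {y \<in> Y. \<exists>x\<in>C. adj x y} \<le> k"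
  shows "\<exists>X D. mixed_cut u v X C D"
proof -
  obtain X where X: "{y \<in> Y. \<exists>x\<in>C. adj x y} \<subseteq> X" "X \<subseteq> Y" "card X = k"
    using exists_subset_between[OF small Y(3)] Y(1) finV finite_subset by blast
  have XV: "X \<subseteq> V" using X Y by blast
  have "odd (card (V - X)) \<longleftrightarrow> odd (card C) \<noteq> odd (card (V - X - C))"
    using finV C(1) X Y by (intro odd_split) auto
  moreover have "even (card (V - X))" using pm_even_card[OF fc[OF XV X(3)]] .
  ultimately have "odd (card (V - X - C))" using C(2) by blast
  moreover have "x = u \<and> y = v" if "x \<in> C" "y \<in> V - X - C" "adj x y" for x y
    using nbr[OF that(1,3)] that X by blast
  ultimately have "mixed_cut u v X C (V - X - C)"
    unfolding mixed_cut_def using X Y C v adjV2[OF v(1)] by blast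
  then show ?thesis by blast
qed

lemma pm_adj_del: "pm adj S \<Longrightarrow> u \<notin> S \<or> v \<notin> S \<Longrightarrow> pm (adj_del u v) S"
  by (erule pm_mono) (auto simp: adj_del_def doubleton_eq_iff)

lemma critical_edge_cut:
  assumes crit: "critical u v"
  shows "(\<exists>X C D. mixed_cut u v X C D) \<or> (\<exists>W C D R. twin_cut u v W C D R)"
proof -
  have uv: "adj u v" using crit unfolding critical_def by blast
  have uvV: "u \<in> V" "v \<in> V" "u \<noteq> v" using uv adjV adjV2 irrefl by blast+
  \<comment> \<open>a smallest set that loses its perfect matching with \<open>uv\<close> and has few neighbours outside\<close>
  define bad where "bad = (\<lambda>P. P \<subseteq> V \<and> u \<in> P \<and> v \<in> P \<and> even (card P) \<and> \<not> pm (adj_del u v) P \<and>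
     (\<exists>Y. Y \<subseteq> V \<and> P \<inter> Y = {} \<and> (card Y = k \<or> card Y = k + 1) \<and> (\<forall>x\<in>P. \<forall>y. adj x y \<longrightarrow> y \<in> P \<union> Y)))"
  have badI: "bad P" if "P \<subseteq> V" "u \<in> P" "v \<in> P" "even (card P)" "\<not> pm (adj_del u v) P"
      "Y \<subseteq> V" "P \<inter> Y = {}" "card Y = k \<or> card Y = k + 1"
      "\<And>x y. x \<in> P \<Longrightarrow> adj x y \<Longrightarrow> y \<in> P \<union> Y" for P Y
  proof -
    have "\<forall>x\<in>P. \<forall>y. adj x y \<longrightarrow> y \<in> P \<union> Y" using that(9) by blast
    then show ?thesis unfolding bad_def using that(1-8) by (intro conjI exI[of _ Y])
  qed
  obtain X0 where X0: "X0 \<subseteq> V" "card X0 = k" "\<not> pm (adj_del u v) (V - X0)"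
    using crit unfolding critical_def by blast
  have "u \<in> V - X0" "v \<in> V - X0" using pm_adj_del[OF fc[OF X0(1,2)]] X0(3) by blast+
  then have "bad (V - X0)"
    unfolding bad_def using X0 pm_even_card[OF fc[OF X0(1,2)]] adjV2 by blast
  then obtain P where P: "bad P" and min: "\<And>P'. bad P' \<Longrightarrow> card P \<le> card P'"
    using exists_least_iff[of "\<lambda>n. \<exists>P. bad P \<and> card P = n"] by (metis (mono_tags, lifting) not_le)
  have PV: "P \<subseteq> V" and uP: "u \<in> P" and vP: "v \<in> P" and evP: "even (card P)"
    and nopm: "\<not> pm (adj_del u v) P" using P unfolding bad_def by blast+
  obtain Y where Y: "Y \<subseteq> V" "P \<inter> Y = {}" "card Y = k \<or> card Y = k + 1"
    and nbr: "\<And>x y. x \<in> P \<Longrightarrow> adj x y \<Longrightarrow> y \<in> P \<union> Y"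
    using P unfolding bad_def by blast
  have finP: "finite P" and finY: "finite Y" using PV Y finV finite_subset by blast+
  have smaller: "\<not> bad P'" if "P' \<subset> P" for P'
    using min[of P'] psubset_card_mono[OF finP that] by auto
  define R where "R = V - P - Y"
  have nbrR: "y \<in> R \<union> Y" if "x \<in> R" "adj x y" for x y
    using nbr[OF _ sym[OF that(2)]] that adjV2 unfolding R_def by blast
  \<comment> \<open>\<open>card V\<close> has the parity of \<open>k\<close> and
    \<open>card P\<close> is even.\<close>
  have oddR: "odd (card R)" if "card Y = k + 1"
  proof -
    have "odd (card (V - P)) \<longleftrightarrow> odd (card Y) \<noteq> odd (card (V - P - Y))"
      using finV Y by (intro odd_split) auto
    then show ?thesis using odd_split[OF finV PV] parity evP that unfolding R_def by auto
  qed
  have touchR: "\<exists>r\<in>R. adj y r" if "card Y = k + 1" "y \<in> Y" for y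
  proof (rule odd_touches_all[OF _ oddR[OF that(1)] Y(1) _ _ uvV(1) _ _ nbrR that(2)])
  qed (use that uP Y in \<open>auto simp: R_def\<close>)
  have touchP: "\<exists>z\<in>Z. adj y z"
    if Z: "Z \<subset> P" "odd (card Z)" "y \<in> Y" "\<And>x y. x \<in> Z \<Longrightarrow> adj x y \<Longrightarrow> y \<in> Z \<union> Y" for Z y
  proof -
    obtain z0 where "z0 \<in> P" "z0 \<notin> Z" using Z(1) by blast
    then show ?thesis
      using that PV Y by (intro odd_touches_all[of Z Y z0 y]) auto
  qed
  \<comment> \<open>Both \<open>Q\<close> and \<open>P - Q\<close> would be odd, forcing
    \<open>card Y = k + 1\<close>; a vertex of \<open>Y\<close> would then have neighbours in
    \<open>Q\<close>, \<open>P - Q\<close> and \<open>R\<close>, which is a claw.\<close>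
  have no_odd: False if O: "iso P Q" "odd (card Q)" for Q
  proof -
    have sub: "Q \<subset> P" using iso_subset[OF O(1)] O(2) evP by blast
    have sub': "P - Q \<subset> P" using sub O(2) by (cases "Q = {}") auto
    have nQ: "y \<in> Q \<union> Y" if "x \<in> Q" "adj x y" for x y
      using nbr[OF _ that(2)] isoD[OF O(1) that] that sub by blast
    have nQ': "y \<in> (P - Q) \<union> Y" if "x \<in> P - Q" "adj x y" for x y
      using nbr[OF _ that(2)] isoD[OF iso_compl[OF O(1)] that] that sub by blast
    obtain z0 where z0: "z0 \<in> P" "z0 \<notin> Q" using sub by blast
    have "k + 1 \<le> card Y"
    proof (rule boundary_ge(2)[of Q Y z0, OF _ _ Y(1) _ _ z0(2) _ nQ O(2)])
    qed (use sub PV Y(2) z0 O(2) in auto)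
    then have k1Y: "card Y = k + 1" using Y by linarith
    then obtain y where y: "y \<in> Y" by fastforce
    have o: "odd (card (P - Q))" using odd_split[OF finP, of Q] sub O evP by auto
    have "\<exists>p\<in>P - Q. adj y p" by (rule touchP[OF sub' o y nQ'])
    then obtain p where p: "p \<in> P - Q" "adj y p" by blast
    have "\<exists>q\<in>Q. adj y q" by (rule touchP[OF sub O(2) y nQ])
    then obtain q where q: "q \<in> Q" "adj y q" by blast
    obtain r where r: "r \<in> R" "adj y r" using touchR[OF k1Y y] by blast
    have "adj p q \<or> adj p r \<or> adj q r"
      using claw[OF p(2) q(2) r(2)] p q r sub unfolding R_def by blast
    then show False using nQ[OF q(1) sym] nQ[OF q(1)] nQ'[OF p(1)] p q r sub Y unfolding R_def by blast
  qed
  \<comment> \<open>Only \<open>c\<close> may have neighbours in \<open>P\<close> outside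
    \<open>S\<close>. Of an isolated part of \<open>S\<close> and its complement in
    \<open>S\<close>, the one without \<open>c\<close> is isolated in \<open>P\<close>, hence even,
    and then so is the other.\<close>
  have pm_iso: "pm adj S" if S: "S \<subseteq> P" "even (card S)"
      and c: "\<And>x y. x \<in> S \<Longrightarrow> x \<noteq> c \<Longrightarrow> adj x y \<Longrightarrow> y \<in> P \<Longrightarrow> y \<in> S" for S c
  proof (rule pm_if_isolated_even)
    show finS: "finite S" using S finP finite_subset by blast
    fix T assume T: "iso S T"
    have iso: "iso P U" if "iso S U" "c \<notin> U" for U
    proof (rule isoI)
      show "U \<subseteq> P" using iso_subset[OF that(1)] S by blast
      show "y \<in> U" if "x \<in> U" "adj x y" "y \<in> P" for x y
        using isoD[OF \<open>iso S U\<close> that(1,2)] c[OF _ _ that(2,3)] that(1) \<open>c \<notin> U\<close> iso_subset[OF \<open>iso S U\<close>] by blast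
    qed
    have "iso P T \<or> iso P (S - T)" using iso[OF T] iso[OF iso_compl[OF T]] by blast
    moreover have "odd (card (S - T))" if "odd (card T)"
      using odd_split[OF finS iso_subset[OF T]] that S by blast
    ultimately show "even (card T)" using no_odd by blast
  qed
  show ?thesis
  proof (cases "\<forall>T. T \<subseteq> P - {u} \<longrightarrow> T \<noteq> {} \<longrightarrow>
        (\<exists>x\<in>T. \<exists>y\<in>P - T - {u}. adj x y) \<or> (\<exists>x\<in>T. adj u x \<and> x \<notin> {v})")
    \<comment> \<open>Here the only edge of \<open>P\<close> that can leave \<open>T\<close> is
      \<open>uv\<close>. If \<open>v\<close> is not in \<open>T\<close>, then \<open>T\<close> can
      be matched separately and \<open>P - T\<close> is a smaller bad set; otherwise
      \<open>uv\<close> is the only link between two sides, which must be odd.\<close>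
    case False
    then obtain T where T: "T \<subseteq> P - {u}" "T \<noteq> {}"
      and T_rest: "\<not> (\<exists>x\<in>T. \<exists>y\<in>P - T - {u}. adj x y)" and T_u: "\<not> (\<exists>x\<in>T. adj u x \<and> x \<notin> {v})"
      by blast
    have Tn: "y \<in> T \<or> x = v \<and> y = u" if "x \<in> T" "adj x y" "y \<in> P" for x y
      using T_rest T_u that sym[OF that(2)] by blast
    have Tn': "y \<in> P - T \<or> x = u \<and> y = v" if "x \<in> P - T" "adj x y" "y \<in> P" for x y
      using Tn[OF _ sym[OF that(2)]] that by blast
    have parts: "T \<union> (P - T) = P" using T by blast
    show ?thesis
    proof (cases "v \<in> T")
      case False
      have isoT: "iso P T" using T Tn False by (intro isoI) blast+
      have "even (card T)" using no_odd isoT by blast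
      have "pm adj T"
        by (rule pm_iso[of T v]) (use T Tn False \<open>even (card T)\<close> in blast)+
      then have "pm (adj_del u v) T" using False by (intro pm_adj_del) auto
      then have "\<not> pm (adj_del u v) (P - T)"
        using pm_Un[of "adj_del u v" T "P - T"] parts nopm by auto
      moreover have "even (card (P - T))"
        using odd_split[OF finP iso_subset[OF isoT]] \<open>even (card T)\<close> evP by blast
      moreover have "y \<in> (P - T) \<union> Y" if "x \<in> P - T" "adj x y" for x y
        using nbr[OF _ that(2)] Tn'[OF that] that False vP by blast
      ultimately have "bad (P - T)"
        by (intro badI[of "P - T" Y]) (use PV uP vP False T Y in blast)+
      moreover have "P - T \<subset> P" using T by blast
      ultimately show ?thesis using smaller by blast
    next
      case True
      have oT: "odd (card T)"
      proof
        assume ev: "even (card T)"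
        have sub: "T \<subseteq> P" using T by blast
        have ev': "even (card (P - T))" using odd_split[OF finP sub] ev evP by blast
        have "pm adj T" by (rule pm_iso[of T v]) (use T Tn ev in blast)+
        moreover have "pm adj (P - T)" by (rule pm_iso[of _ u]) (use Tn' ev' in blast)+
        ultimately have "pm (adj_del u v) (T \<union> (P - T))"
          using T True by (intro pm_Un pm_adj_del) auto
        then show False using nopm parts by simp
      qed
      have oT': "odd (card (P - T))" using odd_split[OF finP, of T] T oT evP by auto
      let ?C = "P - T"
      have nC: "y \<in> ?C \<union> Y \<or> x = u \<and> y = v" if "x \<in> ?C" "adj x y" for x y
        using nbr[OF _ that(2)] Tn'[OF that] that by blast
      have nT: "y \<in> T \<union> Y \<or> x = v \<and> y = u" if "x \<in> T" "adj x y" for x y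
        using nbr[OF _ that(2)] Tn[OF that] that T by blast
      show ?thesis
      proof (cases "card {y \<in> Y. \<exists>x\<in>?C. adj x y} \<le> k \<or> card {y \<in> Y. \<exists>x\<in>T. adj x y} \<le> k")
        case small: True
        have "\<exists>X D. mixed_cut u v X ?C D" if "card {y \<in> Y. \<exists>x\<in>?C. adj x y} \<le> k"
          by (rule mixed_cut_if_odd_side[of ?C u v Y])
             (use PV oT' uP T True uv Y vP that nC in auto)
        moreover have "\<exists>X D. mixed_cut v u X T D" if "card {y \<in> Y. \<exists>x\<in>T. adj x y} \<le> k"
          by (rule mixed_cut_if_odd_side[of T v u Y])
             (use PV oT uP T True sym[OF uv] Y vP that nT in auto)
        ultimately show ?thesis using small mixed_cut_sym by blast
      next
        case big: False
        have full: "S = Y" "card Y = k + 1" if "S \<subseteq> Y" "\<not> card S \<le> k" for S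
          using that Y(3) card_mono[OF finY that(1)] card_subset_eq[OF finY that(1)] by linarith+
        have kY: "card Y = k + 1" using full(2)[of "{y \<in> Y. \<exists>x\<in>T. adj x y}"] big by blast
        have tC: "\<exists>x\<in>?C. adj x y" if "y \<in> Y" for y
          using full(1)[of "{y \<in> Y. \<exists>x\<in>?C. adj x y}"] big that by blast
        have tT: "\<exists>x\<in>T. adj x y" if "y \<in> Y" for y
          using full(1)[of "{y \<in> Y. \<exists>x\<in>T. adj x y}"] big that by blast
        \<comment> \<open>A third neighbour of \<open>y\<close> in \<open>R\<close> makes
          \<open>c\<close> and \<open>d\<close> adjacent, and \<open>uv\<close> is the only edge
          between the two sides.\<close>
        have pinned: "c = u \<and> d = v" if y: "y \<in> Y" and c: "c \<in> ?C" "adj y c" and d: "d \<in> T" "adj y d" for y c d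
        proof -
          obtain r where r: "r \<in> R" "adj y r" using touchR[OF kY y] by blast
          have "adj c d \<or> adj c r \<or> adj d r"
            using claw[OF c(2) d(2) r(2)] c d r T unfolding R_def by blast
          moreover have "\<not> adj c r" "\<not> adj d r" using nbr r c d T unfolding R_def by blast+
          ultimately show ?thesis using Tn'[OF c(1)] d T by blast
        qed
        have W: "adj w u \<and> adj w v \<and> (\<forall>x\<in>?C. adj w x \<longrightarrow> x = u) \<and> (\<forall>x\<in>T. adj w x \<longrightarrow> x = v) \<and>
            (\<exists>r\<in>R. adj w r)" if w: "w \<in> Y" for w
        proof -
          obtain c d where "c \<in> ?C" "adj w c" "d \<in> T" "adj w d" using tC[OF w] tT[OF w] sym by blast
          then show ?thesis using pinned[OF w] touchR[OF kY w] by blast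
        qed
        have "\<forall>x\<in>?C. \<forall>y\<in>T. adj x y \<longrightarrow> x = u \<and> y = v"
          using Tn' T by blast
        moreover have "\<forall>x\<in>?C \<union> T. \<forall>y\<in>R. \<not> adj x y"
          using nbr T unfolding R_def by blast
        moreover have "\<forall>w\<in>Y. adj w u \<and> adj w v \<and> (\<forall>x\<in>?C. adj w x \<longrightarrow> x = u) \<and>
            (\<forall>x\<in>T. adj w x \<longrightarrow> x = v) \<and> (\<exists>r\<in>R. adj w r)"
          using W by (rule ballI)
        moreover have "Y \<union> ?C \<union> T \<union> R = V" using Y PV T unfolding R_def by blast
        moreover have "Y \<inter> ?C = {}" "Y \<inter> T = {}" "Y \<inter> R = {}" "?C \<inter> T = {}" "?C \<inter> R = {}" "T \<inter> R = {}"
          using Y T unfolding R_def by blast+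
        moreover have "u \<in> ?C" using uP T by blast
        ultimately have "twin_cut u v Y ?C T R"
          unfolding twin_cut_def using kY oT oT' oddR[OF kY] True uv by (intro conjI)
        then show ?thesis by blast
      qed
    qed
  next
    case conn: True
    have odd_rest: "\<exists>T. iso (P - {u, w}) T \<and> odd (card T)" if w: "w \<in> P" "adj u w" "w \<notin> {v}" for w
    proof (rule ccontr)
      assume "\<not> (\<exists>T. iso (P - {u, w}) T \<and> odd (card T))"
      then have "pm adj (P - {u, w})" using finP by (intro pm_if_isolated_even) auto
      then have "pm (adj_del u v) (P - {u, w})" by (intro pm_adj_del) auto
      then have "pm (adj_del u v) (insert u (insert w (P - {u, w})))"
        using w irrefl uvV by (intro pm.insert) (auto simp: adj_del_def doubleton_eq_iff)
      moreover have "insert u (insert w (P - {u, w})) = P" using w uP by blast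
      ultimately show False using nopm by simp
    qed
    have "\<exists>w D. w \<in> P \<and> adj u w \<and> w \<notin> {v} \<and> (\<exists>b\<in>{v}. adj w b) \<and> D \<subseteq> P - {u, w} \<and> D \<inter> {v} = {} \<and>
        odd (card D) \<and> (\<forall>x\<in>D. \<forall>y\<in>P. adj x y \<longrightarrow> y \<in> insert w D)"
      by (rule forced_cut_vertex[OF finP uP evP subset_refl conn[rule_format] odd_rest])
    then obtain w D where w: "w \<in> P" "adj u w" "w \<noteq> v" "adj w v"
      and D: "D \<subseteq> P - {u, w}" "v \<notin> D" "odd (card D)"
      and Dn: "\<And>x y. x \<in> D \<Longrightarrow> adj x y \<Longrightarrow> y \<in> P \<Longrightarrow> y \<in> insert w D"
      by blast
    have finD: "finite D" using D finP finite_subset by blast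
    define P' where "P' = P - insert w D"
    have wD: "w \<notin> D" "insert w D \<subseteq> P" "u \<noteq> w" using D w irrefl by blast+
    have evD: "even (card (insert w D))" using D(3) wD finD by simp
    have evP': "even (card P')" unfolding P'_def using odd_split[OF finP wD(2)] evP evD by blast
    have uvP': "u \<in> P'" "v \<in> P'" unfolding P'_def using D w uP vP wD by blast+
    have "pm adj (insert w D)"
      by (rule pm_iso[of _ w]) (use wD evD Dn in blast)+
    then have "pm (adj_del u v) (insert w D)" using D w by (intro pm_adj_del) auto
    then have nopm': "\<not> pm (adj_del u v) P'"
      using pm_Un[of "adj_del u v" "insert w D" P'] nopm wD(2) unfolding P'_def
      by (metis Diff_disjoint Diff_partition)
    have nP': "y \<in> P' \<union> insert w Y" if "x \<in> P'" "adj x y" for x y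
      using nbr[OF _ that(2)] Dn[OF _ sym[OF that(2)]] that unfolding P'_def by blast
    have sub: "P' \<subset> P" unfolding P'_def using w by blast
    have wY: "w \<notin> Y" using w Y by blast
    define Y1 where "Y1 = {y \<in> Y. \<exists>d\<in>D. adj y d}"
    \<comment> \<open>If \<open>Y\<close> already has \<open>k + 1\<close> vertices, those with a
      neighbour in \<open>D\<close> are dropped. They also have a neighbour in \<open>R\<close>, so
      by claw-freeness they have none in \<open>P'\<close>.\<close>
    define Y' where "Y' = (if card Y = k then insert w Y else insert w (Y - Y1))"
    have Y'V: "Y' \<subseteq> V" "P' \<inter> Y' = {}" unfolding Y'_def P'_def using Y w PV by auto
    have nY': "y \<in> P' \<union> Y'" if x: "x \<in> P'" "adj x y" for x y
    proof (rule ccontr)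
      assume no: "y \<notin> P' \<union> Y'"
      then have kY: "card Y = k + 1" and y: "y \<in> Y1" using nP'[OF x] Y(3) unfolding Y'_def by (auto split: if_splits)
      obtain d where d: "d \<in> D" "adj y d" using y unfolding Y1_def by blast
      obtain r where r: "r \<in> R" "adj y r" using touchR[OF kY] y unfolding Y1_def by blast
      have "adj x d \<or> adj x r \<or> adj d r"
        using claw[OF sym[OF x(2)] d(2) r(2)] x d r D unfolding R_def P'_def by blast
      moreover have "\<not> adj x r" "\<not> adj d r" using nbr r x d D unfolding R_def P'_def by blast+
      moreover have "\<not> adj x d" using Dn[OF d(1) sym] x(1) unfolding P'_def by blast
      ultimately show False by blast
    qed
    have cY': "card Y' = k \<or> card Y' = k + 1"
    proof (cases "card Y = k")
      case True
      then show ?thesis unfolding Y'_def using wY finY by simp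
    next
      case False
      then have kY: "card Y = k + 1" using Y(3) by blast
      have finY1: "finite Y1" unfolding Y1_def using finY by simp
      have "k + 1 \<le> card (insert w Y1)"
      proof (rule boundary_ge(2)[of D _ u])
        show "y \<in> D \<union> insert w Y1" if "x \<in> D" "adj x y" for x y
          using nbr[OF _ that(2)] Dn[OF that] that D sym unfolding Y1_def by blast
      qed (use D PV Y w wD uP in \<open>auto simp: Y1_def\<close>)
      then have "k \<le> card Y1" using wY finY1 unfolding Y1_def by (simp split: if_splits)
      \<comment> \<open>The odd set \<open>D\<close> has boundary within \<open>insert w Y1\<close>,
        so \<open>Y1\<close> is nearly all of \<open>Y\<close>. The resulting bounds
        \<open>k \<le> card Y' \<le> 2\<close> suffice because \<open>k\<close> is at least
        1.\<close>
      then have "card (Y - Y1) \<le> 1"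
        using kY finY1 card_Diff_subset[of Y1 Y] unfolding Y1_def by auto
      then have "card Y' \<le> 2" unfolding Y'_def using False finY wY by simp
      moreover have "k \<le> card Y'"
      proof -
        obtain r where r: "r \<in> R" using oddR[OF kY] by fastforce
        show ?thesis
          by (rule boundary_ge(1)[of P' Y' r])
             (use r sub PV uvP' Y'V nY' w False in \<open>auto simp: R_def Y'_def\<close>)
      qed
      ultimately show ?thesis using k1 by linarith
    qed
    have "P' \<subseteq> V" using sub PV by blast
    then have "bad P'" by (rule badI[OF _ uvP' evP' nopm' Y'V cY' nY'])
    then show ?thesis using smaller[OF sub] by blast
  qed
qed

text \<open>A second twin cut, at \<open>uw\<close>, would have
  \<open>W' = insert v (W - {w})\<close>. Then \<open>w\<close> alone separates
  \<open>D' - {w}\<close> from the rest, and the part of \<open>R\<close> in there is odd, although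
  odd sets need \<open>k + 1\<close> boundary vertices.\<close>

lemma twin_cut_spoke:
  assumes N: "twin_cut u v W C D R" and w: "w \<in> W" and crit: "critical u w"
  shows "\<exists>X C D. mixed_cut u w X C D"
proof (rule ccontr)
  assume "\<nexists>X C D. mixed_cut u w X C D"
  then obtain W' C' D' R' where N': "twin_cut u w W' C' D' R'"
    using critical_edge_cut[OF crit] by blast
  have V: "W \<union> C \<union> D \<union> R = V" "W \<inter> R = {}" "C \<inter> R = {}" "D \<inter> R = {}" "W \<inter> C = {}"
    and cW: "card W = k + 1" and oR: "odd (card R)" and u: "u \<in> C" "v \<in> D"
    using N unfolding twin_cut_def by simp_all
  have "\<forall>x\<in>C \<union> D. \<forall>y\<in>R. \<not> adj x y" using N unfolding twin_cut_def by (elim conjE)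
  then have nR: "\<not> adj x y" if "x \<in> C \<union> D" "y \<in> R" for x y using that by blast
  have "\<forall>w\<in>W. adj w u \<and> adj w v \<and> (\<forall>x\<in>C. adj w x \<longrightarrow> x = u) \<and> (\<forall>x\<in>D. adj w x \<longrightarrow> x = v) \<and>
      (\<exists>r\<in>R. adj w r)"
    using N unfolding twin_cut_def by (elim conjE)
  then have WC: "\<And>x y. x \<in> W \<Longrightarrow> y \<in> C \<Longrightarrow> adj x y \<Longrightarrow> y = u"
    and WD: "\<And>x y. x \<in> W \<Longrightarrow> y \<in> D \<Longrightarrow> adj x y \<Longrightarrow> y = v" by blast+
  have V': "W' \<union> C' \<union> D' \<union> R' = V" "W' \<inter> D' = {}"
    and cW': "card W' = k + 1" and u': "u \<in> C'" "w \<in> D'"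
    using N' unfolding twin_cut_def by simp_all
  have "\<forall>x\<in>C'. \<forall>y\<in>D'. adj x y \<longrightarrow> x = u \<and> y = w" using N' unfolding twin_cut_def by (elim conjE)
  then have CD': "x = u \<and> y = w" if "x \<in> C'" "y \<in> D'" "adj x y" for x y using that by blast
  have "\<forall>x\<in>C' \<union> D'. \<forall>y\<in>R'. \<not> adj x y" using N' unfolding twin_cut_def by (elim conjE)
  then have nR': "\<not> adj x y" if "x \<in> C' \<union> D'" "y \<in> R'" for x y using that by blast
  have "\<forall>x\<in>W'. adj x u \<and> adj x w \<and> (\<forall>y\<in>C'. adj x y \<longrightarrow> y = u) \<and> (\<forall>y\<in>D'. adj x y \<longrightarrow> y = w) \<and>
      (\<exists>r\<in>R'. adj x r)"
    using N' unfolding twin_cut_def by (elim conjE)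
  then have W': "\<And>x. x \<in> W' \<Longrightarrow> adj x u \<and> adj x w"
    and WD': "\<And>x y. x \<in> W' \<Longrightarrow> y \<in> D' \<Longrightarrow> adj x y \<Longrightarrow> y = w" by blast+
  have finW: "finite W" using V finV by (metis finite_Un)
  have W'sub: "W' \<subseteq> insert v (W - {w})"
  proof
    fix z assume z: "z \<in> W'"
    have a: "adj u z" "adj w z" using W'[OF z] sym by blast+
    have "z \<in> V" using z V' by blast
    moreover have "z \<notin> C" using WC[OF w _ a(2)] a irrefl by blast
    moreover have "z \<in> D \<Longrightarrow> z = v" using WD[OF w _ a(2)] by blast
    moreover have "z \<notin> R" using nR a u by blast
    moreover have "z \<noteq> w" using a irrefl by blast
    ultimately show "z \<in> insert v (W - {w})" using V by blast
  qed
  have "card (insert v (W - {w})) \<le> k + 1"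
    using card_insert_le_m1[of "k + 1" "W - {w}" v] cW w finW by simp
  then have W'eq: "W' = insert v (W - {w})"
    using W'sub cW' finW by (intro card_seteq) auto
  define Z where "Z = D' - {w}"
  have nZ: "y \<in> insert w Z" if z: "z \<in> Z" "adj z y" for z y
  proof -
    have zD: "z \<in> D'" "z \<noteq> w" using z unfolding Z_def by blast+
    have "y \<notin> W'" using WD'[OF _ zD(1) sym[OF z(2)]] zD by blast
    moreover have "y \<notin> C'" using CD'[OF _ zD(1) sym[OF z(2)]] zD by blast
    moreover have "y \<notin> R'" using nR' z(2) zD by blast
    ultimately show ?thesis using adjV2[OF z(2)] V' unfolding Z_def by blast
  qed
  have wR: "y \<in> Z" if y: "y \<in> R" "adj w y" for y
  proof -
    have "y \<notin> W'" using W'eq y V u by blast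
    moreover have "y \<notin> C'" using CD'[OF _ u'(2) sym[OF y(2)]] y u V by blast
    moreover have "y \<notin> R'" using nR' u' y by blast
    ultimately show ?thesis using y V V' irrefl unfolding Z_def by blast
  qed
  define Q where "Q = R \<inter> Z"
  have QR: "Q \<subseteq> R" unfolding Q_def by blast
  have finR: "finite R" using V finV by (metis finite_Un)
  have RV: "R \<subseteq> V" using V by blast
  have uV: "u \<in> V" "u \<notin> R" "u \<notin> W" using u V by blast+
  have nR_out: "y \<in> R \<union> W" if "x \<in> R" "adj x y" for x y
    using adjV2[OF that(2)] nR[OF _ that(1)] sym[OF that(2)] V by blast
  \<comment> \<open>All neighbours of \<open>w\<close> in \<open>R\<close> lie in \<open>Q\<close>,
    so the boundary of \<open>R - Q\<close> lies within the \<open>k\<close> vertices of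
    \<open>W - {w}\<close>.\<close>
  have "\<not> odd (card (R - Q))"
  proof
    assume o: "odd (card (R - Q))"
    have "k + 1 \<le> card (W - {w})"
    proof (rule boundary_ge(2)[of "R - Q" "W - {w}" u])
      fix x y assume x: "x \<in> R - Q" and a: "adj x y"
      have "y \<noteq> w" using wR[of x] x sym[OF a] unfolding Q_def by blast
      moreover have "y \<notin> Q" using nZ[OF _ sym[OF a]] x w V unfolding Q_def by blast
      ultimately show "y \<in> (R - Q) \<union> (W - {w})" using nR_out[OF _ a] x by blast
    next
      show "R - Q \<noteq> {}" using o by (metis card.empty even_zero)
    qed (use o uV RV V in auto)
    then show False using cW w finW by simp
  qed
  then have oQ: "odd (card Q)" using odd_split[OF finR QR] oR by blast
  have "k + 1 \<le> card {w}"
  proof (rule boundary_ge(2)[of Q "{w}" u])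
    fix x y assume x: "x \<in> Q" and a: "adj x y"
    have "y \<in> insert w Z" using nZ[OF _ a] x unfolding Q_def by blast
    moreover have "y \<in> R \<union> W" using nR_out[OF _ a] x unfolding Q_def by blast
    moreover have "W - {w} \<subseteq> W'" using W'eq by blast
    ultimately show "y \<in> Q \<union> {w}" using V' unfolding Q_def Z_def by blast
  next
    show "Q \<noteq> {}" using oQ by auto
  qed (use oQ uV RV QR V w in auto)
  then show False using k1 by simp
qed

text \<open>The two cuts divide \<open>V\<close> into a three by three grid. The boundaries of the
  opposite corners \<open>C \<inter> C'\<close> and \<open>D \<inter> D'\<close> have together at
  most \<open>card X + card X' = 2 * k\<close> vertices, so any excess over \<open>k\<close> at
  either corner is impossible.\<close>

lemma no_nested_mixed_cuts:
  assumes A: "mixed_cut u v X C D" and B: "mixed_cut u a X' C' D'" and aC: "a \<in> C"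
    and deg: "k + 2 \<le> card {y. adj u y}" and min: "card C \<le> card D'"
  shows False
proof -
  have V: "X \<union> C \<union> D = V" "X \<inter> C = {}" "X \<inter> D = {}" "C \<inter> D = {}"
    and cX: "card X = k" and oC: "odd (card C)" and oD: "odd (card D)"
    and u: "u \<in> C" "v \<in> D" "adj u v"
    and CD: "\<And>x y. x \<in> C \<Longrightarrow> y \<in> D \<Longrightarrow> adj x y \<Longrightarrow> x = u \<and> y = v"
    using A unfolding mixed_cut_def by blast+
  have V': "X' \<union> C' \<union> D' = V" "X' \<inter> C' = {}" "X' \<inter> D' = {}" "C' \<inter> D' = {}"
    and cX': "card X' = k" and oC': "odd (card C')" and oD': "odd (card D')"
    and u': "u \<in> C'" "a \<in> D'" "adj u a"
    and CD': "\<And>x y. x \<in> C' \<Longrightarrow> y \<in> D' \<Longrightarrow> adj x y \<Longrightarrow> x = u \<and> y = a"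
    using B unfolding mixed_cut_def by blast+
  have nC: "y \<in> C \<union> X \<or> x = u \<and> y = v" if "x \<in> C" "adj x y" for x y
    using CD[OF that(1) _ that(2)] adjV2[OF that(2)] V by blast
  have nD: "y \<in> D \<union> X \<or> x = v \<and> y = u" if "x \<in> D" "adj x y" for x y
    using CD[OF _ that(1) sym[OF that(2)]] adjV2[OF that(2)] V by blast
  have nC': "y \<in> C' \<union> X' \<or> x = u \<and> y = a" if "x \<in> C'" "adj x y" for x y
    using CD'[OF that(1) _ that(2)] adjV2[OF that(2)] V' by blast
  have nD': "y \<in> D' \<union> X' \<or> x = a \<and> y = u" if "x \<in> D'" "adj x y" for x y
    using CD'[OF _ that(1) sym[OF that(2)]] adjV2[OF that(2)] V' by blast
  have fin: "finite X" "finite C" "finite D" "finite X'" "finite C'" "finite D'"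
    using V V' finV by (metis finite_Un)+
  have uV: "u \<in> V" "a \<in> V" using u'(3) adjV adjV2 by blast+
  \<comment> \<open>As \<open>v\<close> is adjacent to neither \<open>a\<close> nor
    \<open>b\<close>, claw-freeness at \<open>u\<close> gives the edge \<open>ab\<close>. Then
    \<open>b\<close> can lie neither in \<open>C'\<close> nor in \<open>D'\<close>.\<close>
  have clique: "b \<in> X'" if b: "b \<in> C" "adj u b" "b \<noteq> a" for b
  proof -
    have "\<not> adj a v" "\<not> adj b v" using CD u aC b u'(3) irrefl by blast+
    then have ab: "adj a b"
      using claw[OF u'(3) b(2) u(3)] b aC u V by blast
    have "b \<notin> D'" using CD'[OF u'(1) _ b(2)] b by blast
    moreover have "b \<notin> C'" using CD'[OF _ u'(2) sym[OF ab]] b irrefl by blast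
    ultimately show ?thesis using V V' b by blast
  qed
  define Y where "Y = (X \<inter> C') \<union> (X \<inter> X') \<union> (C \<inter> X')"
  have finY: "finite Y" unfolding Y_def using fin by simp
  have cY: "card Y \<le> card (X \<inter> C') + card (X \<inter> X') + card (C \<inter> X')"
    unfolding Y_def by (meson card_Un_le le_trans add_le_mono1)
  \<comment> \<open>By the previous claim \<open>u\<close> has no neighbour within the corner. Hence
    either the corner is \<open>{u}\<close> and the degree of \<open>u\<close> bounds
    \<open>Y\<close>, or removing \<open>u\<close> flips the parity of the corner while the boundary
    stays within \<open>Y\<close>.\<close>
  have corner: "k \<le> card Y \<and> (even (card (C \<inter> C')) \<longrightarrow> k + 1 \<le> card Y)"
  proof (cases "C \<inter> C' = {u}")
    case True
    have "{y. adj u y} \<subseteq> {a, v} \<union> Y"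
    proof
      fix y assume "y \<in> {y. adj u y}"
      then have a: "adj u y" by simp
      then have "y \<notin> C \<inter> C'" using True irrefl by auto
      then show "y \<in> {a, v} \<union> Y" using nC[OF u(1) a] nC'[OF u'(1) a] unfolding Y_def by blast
    qed
    then have "card {y. adj u y} \<le> card ({a, v} \<union> Y)" using finY by (intro card_mono) auto
    also have "\<dots> \<le> card {a, v} + card Y" by (rule card_Un_le)
    also have "\<dots> \<le> 2 + card Y" by (simp add: card_insert_if)
    finally show ?thesis using deg True by simp
  next
    case False
    let ?Z = "C \<inter> C' - {u}"
    have Z: "?Z \<noteq> {}" "?Z \<subseteq> V" "Y \<subseteq> V" "?Z \<inter> Y = {}" "u \<notin> ?Z" "u \<notin> Y"
      using False u u' V V' unfolding Y_def by blast+
    have nZ: "y \<in> ?Z \<union> Y" if "x \<in> ?Z" "adj x y" for x y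
    proof -
      have x: "x \<in> C" "x \<in> C'" "x \<noteq> u" using that by blast+
      have "y \<noteq> u"
        using clique[OF x(1)] sym[OF that(2)] x u'(2) V' by blast
      then show ?thesis using nC[OF x(1) that(2)] nC'[OF x(2) that(2)] x unfolding Y_def by blast
    qed
    have "odd (card ?Z)" if "even (card (C \<inter> C'))"
      using that u u' fin odd_split[of "C \<inter> C'" "{u}"] by simp
    moreover have "k \<le> card Y" by (rule boundary_ge(1)[OF Z(2,1,3,4) uV(1) Z(5,6) nZ])
    moreover have "k + 1 \<le> card Y" if "odd (card ?Z)"
      by (rule boundary_ge(2)[OF Z(2,1,3,4) uV(1) Z(5,6) nZ that])
    ultimately show ?thesis by blast
  qed
  define Y3 where "Y3 = (X \<inter> D') \<union> (X \<inter> X') \<union> (D \<inter> X')"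
  have cY3: "card Y3 \<le> card (X \<inter> D') + card (X \<inter> X') + card (D \<inter> X')"
    unfolding Y3_def by (meson card_Un_le le_trans add_le_mono1)
  have opposite: "D \<inter> D' = {} \<or> k \<le> card Y3 \<and> (odd (card (D \<inter> D')) \<longrightarrow> k + 1 \<le> card Y3)"
  proof (cases "D \<inter> D' = {}")
    case False
    have Z: "D \<inter> D' \<subseteq> V" "Y3 \<subseteq> V" "(D \<inter> D') \<inter> Y3 = {}" "u \<notin> D \<inter> D'" "u \<notin> Y3"
      using u u' V V' unfolding Y3_def by blast+
    have nZ: "y \<in> (D \<inter> D') \<union> Y3" if "x \<in> D \<inter> D'" "adj x y" for x y
    proof -
      have x: "x \<in> D" "x \<in> D'" "x \<noteq> a" using that aC V by blast+
      \<comment> \<open>\<open>v\<close> is not in \<open>D'\<close>: the edge \<open>uv\<close>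
        would force \<open>v = a\<close>, but \<open>a\<close> lies in \<open>C\<close>. So neither
        exceptional edge leaves this corner.\<close>
      have "x \<noteq> v \<or> y \<noteq> u" using CD'[OF u'(1) x(2)] x u(3) by blast
      then show ?thesis using nD[OF x(1) that(2)] nD'[OF x(2) that(2)] x unfolding Y3_def by blast
    qed
    have "k \<le> card Y3" by (rule boundary_ge(1)[OF Z(1) False Z(2,3) uV(1) Z(4,5) nZ])
    moreover have "k + 1 \<le> card Y3" if "odd (card (D \<inter> D'))"
      by (rule boundary_ge(2)[OF Z(1) False Z(2,3) uV(1) Z(4,5) nZ that])
    ultimately show ?thesis by blast
  qed simp
  have parts: "card S = card (S \<inter> C') + card (S \<inter> X') + card (S \<inter> D')" if "S \<subseteq> V" "finite S" for S
    using that V' by (intro card_three_parts) auto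
  have parts': "card S = card (C \<inter> S) + card (X \<inter> S) + card (D \<inter> S)" if "S \<subseteq> V" "finite S" for S
    using that V card_three_parts[of S C X D] by (auto simp: Int_commute)
  have sub: "C \<subseteq> V" "X \<subseteq> V" "D \<subseteq> V" "C' \<subseteq> V" "X' \<subseteq> V" "D' \<subseteq> V" using V V' by blast+
  have eqs: "card C = card (C \<inter> C') + card (C \<inter> X') + card (C \<inter> D')"
    "k = card (X \<inter> C') + card (X \<inter> X') + card (X \<inter> D')"
    "card D = card (D \<inter> C') + card (D \<inter> X') + card (D \<inter> D')"
    "card C' = card (C \<inter> C') + card (X \<inter> C') + card (D \<inter> C')"
    "k = card (C \<inter> X') + card (X \<inter> X') + card (D \<inter> X')"
    "card D' = card (C \<inter> D') + card (X \<inter> D') + card (D \<inter> D')"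
    using parts sub fin parts' cX cX' by metis+
  have pos: "1 \<le> card (C \<inter> C')" using u u' fin by (auto simp: Suc_le_eq card_gt_0_iff)
  show False
  \<comment> \<open>If the opposite corner is empty, \<open>D'\<close> is smaller than
    \<open>C\<close>. Otherwise both corner bounds are tight, and the parities of \<open>D\<close>
    and \<open>C'\<close> contradict each other.\<close>
  proof (cases "D \<inter> D' = {}")
    case True
    then show ?thesis using corner cY eqs min pos by simp
  next
    case False
    then have "k \<le> card Y3" and o3: "odd (card (D \<inter> D')) \<longrightarrow> k + 1 \<le> card Y3" using opposite by blast+
    then have "card (D \<inter> X') = card (X \<inter> C')" "even (card (D \<inter> D'))" "odd (card (C \<inter> C'))"
      using corner cY cY3 eqs(2,5) by linarith+
    then show ?thesis using oD oC' eqs(3,4) by simp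
  qed
qed

lemma exists_degree_le:
  assumes crit: "\<And>x y. adj x y \<Longrightarrow> critical x y"
  shows "\<exists>u\<in>V. card {y. adj u y} \<le> k + 1"
proof (rule ccontr)
  assume "\<not> ?thesis"
  then have deg: "k + 2 \<le> card {y. adj u y}" if "u \<in> V" for u using that by force
  have twinW: "card W = k + 1" "\<And>w. w \<in> W \<Longrightarrow> adj x w \<and> adj y w" if N: "twin_cut x y W C D R" for x y W C D R
  proof -
    show "card W = k + 1" using N unfolding twin_cut_def by simp
    have "\<forall>w\<in>W. adj w x \<and> adj w y \<and> (\<forall>z\<in>C. adj w z \<longrightarrow> z = x) \<and> (\<forall>z\<in>D. adj w z \<longrightarrow> z = y) \<and>
        (\<exists>r\<in>R. adj w r)"
      using N unfolding twin_cut_def by (elim conjE)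
    then show "\<And>w. w \<in> W \<Longrightarrow> adj x w \<and> adj y w" using sym by blast
  qed
  have "\<exists>x y X C D. mixed_cut x y X C D"
  proof -
    obtain u where "u \<in> V" using kV by fastforce
    then have "card {y. adj u y} \<noteq> 0" using deg[of u] by simp
    then obtain v where uv: "adj u v" by (metis card.empty empty_Collect_eq)
    show ?thesis
    proof (cases "\<exists>X C D. mixed_cut u v X C D")
      case False
      then obtain W C D R where N: "twin_cut u v W C D R" using critical_edge_cut[OF crit[OF uv]] by blast
      obtain w where w: "w \<in> W" using twinW(1)[OF N] by fastforce
      have "critical u w" using crit twinW(2)[OF N w] by blast
      then show ?thesis using twin_cut_spoke[OF N w] by blast
    qed blast
  qed
  then obtain u v X C D where M: "mixed_cut u v X C D"
    and min: "\<And>x y X' C' D'. mixed_cut x y X' C' D' \<Longrightarrow> card C \<le> card C'"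
    using exists_least_iff[of "\<lambda>n. \<exists>x y X C D. mixed_cut x y X C D \<and> card C = n"]
    by (metis (mono_tags, lifting) not_le)
  have V: "X \<union> C \<union> D = V" "C \<inter> D = {}" "card X = k" and u: "u \<in> C" "v \<in> D" "adj u v"
    and CD: "\<And>x y. x \<in> C \<Longrightarrow> y \<in> D \<Longrightarrow> adj x y \<Longrightarrow> x = u \<and> y = v"
    using M unfolding mixed_cut_def by blast+
  have finX: "finite X" using V finV by (metis finite_Un)
  have uV: "u \<in> V" using u adjV by blast
  have "\<exists>a\<in>C. adj u a"
  proof (rule ccontr)
    assume "\<not> (\<exists>a\<in>C. adj u a)"
    then have "{y. adj u y} \<subseteq> insert v X" using V CD[OF u(1)] adjV2 by blast
    then have "card {y. adj u y} \<le> card (insert v X)" using finX by (intro card_mono) auto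
    then show False using deg[OF uV] V(3) finX by (simp add: card_insert_if split: if_splits)
  qed
  then obtain a0 where a0: "a0 \<in> C" "adj u a0" by blast
  have "\<exists>a\<in>C. \<exists>X C D. mixed_cut u a X C D"
  proof (cases "\<exists>X C D. mixed_cut u a0 X C D")
    case False
    then obtain W C' D' R where N: "twin_cut u a0 W C' D' R"
      using critical_edge_cut[OF crit[OF a0(2)]] by blast
    \<comment> \<open>\<open>W\<close> has one vertex more than \<open>X\<close>. A vertex of
      \<open>W\<close> outside \<open>X\<close> is adjacent to \<open>a0\<close>, which differs from
      \<open>u\<close>, so it cannot lie in \<open>D\<close>.\<close>
    have "\<not> W \<subseteq> X" using card_mono[OF finX, of W] twinW(1)[OF N] V(3) by auto
    then obtain w where w: "w \<in> W" "w \<notin> X" by blast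
    have a: "adj u w" "adj a0 w" using twinW(2)[OF N w(1)] by blast+
    have "w \<notin> D" using CD[OF a0(1) _ a(2)] a0(2) irrefl by blast
    then have "w \<in> C" using w adjV2[OF a(1)] V by blast
    then show ?thesis using twin_cut_spoke[OF N w(1) crit[OF a(1)]] by blast
  qed (use a0 in blast)
  then obtain a X' C' D' where a: "a \<in> C" and M': "mixed_cut u a X' C' D'" by blast
  \<comment> \<open>Reversing the second cut turns \<open>D'\<close> into its first side, so that
    minimality gives \<open>card C \<le> card D'\<close>.\<close>
  show False
    by (rule no_nested_mixed_cuts[OF M M' a deg[OF uV] min[OF mixed_cut_sym[OF M']]])
qed

text \<open>The neighbourhood of \<open>v\<close> is the boundary of the odd set \<open>{v}\<close>.
  If no vertex lies beyond it, the degree is \<open>card V - 1\<close>, and parity excludes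
  \<open>card V = k + 1\<close>.\<close>

lemma degree_ge:
  assumes v: "v \<in> V"
  shows "k + 1 \<le> card {y. adj v y}"
proof (cases "\<exists>z0\<in>V. z0 \<noteq> v \<and> \<not> adj v z0")
  case True
  then obtain z0 where "z0 \<in> V" "z0 \<noteq> v" "\<not> adj v z0" by blast
  then show ?thesis
    using v irrefl adjV2 by (intro boundary_ge(2)[of "{v}" _ z0]) auto
next
  case False
  then have "V - {v} = {y. adj v y}" using irrefl adjV2 by blast
  moreover have "k + 1 \<noteq> card V" using parity by (metis even_plus_one_iff)
  ultimately show ?thesis using card_Diff_singleton[OF v] kV by simp
qed

end

section \<open>The minimum degree\<close>

lemma claw_free_edges:
  assumes cf: "claw_free G" and G: "finite_simple_graph G"
    and e: "{c, x} \<in> edges G" "{c, y} \<in> edges G" "{c, z} \<in> edges G"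
    and d: "x \<noteq> y" "x \<noteq> z" "y \<noteq> z"
  shows "{x, y} \<in> edges G \<or> {x, z} \<in> edges G \<or> {y, z} \<in> edges G"
proof (rule ccontr)
  assume no: "\<not> ?thesis"
  let ?S = "{c, x, y, z}"
  let ?f = "\<lambda>w. if w = c then 0 else if w = x then 1 else if w = y then 2 else (3::nat)"
  have loop: "{w} \<notin> edges G" for w using G unfolding finite_simple_graph_def by fastforce
  have c: "c \<noteq> x" "c \<noteq> y" "c \<noteq> z" using e loop by auto
  have "bij_betw ?f ?S {0, 1, 2, 3}"
    unfolding bij_betw_def inj_on_def using c d by auto
  moreover have "{p, q} \<in> {e \<in> edges G. e \<subseteq> ?S} \<longleftrightarrow> {?f p, ?f q} \<in> {{0, 1}, {0, 2}, {0, 3}}"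
    if "p \<in> ?S" "q \<in> ?S" for p q
    using that c d e no loop by (auto simp: doubleton_eq_iff insert_commute)
  ultimately have "graph_iso (induced_subgraph G ?S) K13"
    unfolding graph_iso_def induced_subgraph_def K13_def by (intro exI[of _ ?f]) auto
  moreover have "?S \<subseteq> verts G" using e G unfolding finite_simple_graph_def by blast
  ultimately show False using cf unfolding claw_free_def by blast
qed

lemma degree_eq_card_neighbours:
  assumes "finite_simple_graph G"
  shows "degree G v = card {y. {v, y} \<in> edges G}"
proof -
  have "{e \<in> edges G. v \<in> e} = (\<lambda>y. {v, y}) ` {y. {v, y} \<in> edges G}"
  proof
    show "{e \<in> edges G. v \<in> e} \<subseteq> (\<lambda>y. {v, y}) ` {y. {v, y} \<in> edges G}"
    proof
      fix e assume e: "e \<in> {e \<in> edges G. v \<in> e}"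
      then have "card e = 2" using assms unfolding finite_simple_graph_def by blast
      then obtain y where "e = {v, y}" using e by (auto simp: card_2_iff insert_commute)
      then show "e \<in> (\<lambda>y. {v, y}) ` {y. {v, y} \<in> edges G}" using e by blast
    qed
  qed auto
  moreover have "inj_on (\<lambda>y. {v, y}) {y. {v, y} \<in> edges G}"
    by (auto simp: inj_on_def doubleton_eq_iff)
  ultimately show ?thesis unfolding degree_def by (simp add: card_image)
qed

lemma perfect_matching_delete_vertices_iff:
  assumes "finite_simple_graph G"
  shows "(\<exists>M. perfect_matching (delete_vertices G X) M) \<longleftrightarrow> pm (\<lambda>x y. {x, y} \<in> edges G) (verts G - X)"
proof -
  have "perfect_matching (delete_vertices G X) M \<longleftrightarrow>
      M \<subseteq> {e \<in> edges G. e \<subseteq> verts G - X} \<and> (\<forall>v\<in>verts G - X. \<exists>!e. e \<in> M \<and> v \<in> e)" for M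
    by (simp add: perfect_matching_def delete_vertices_def induced_subgraph_def)
  moreover have "finite (verts G - X)" "\<forall>e\<in>edges G. card e = 2"
    using assms by (auto simp: finite_simple_graph_def)
  ultimately show ?thesis
    using pm_imp_matching[of "edges G" "verts G - X"] matching_imp_pm[of "verts G - X" _ "edges G"]
    by meson
qed

theorem theorem1p4:
  fixes G :: "'a ugraph" and k :: nat
  assumes "k \<ge> 1"
    and "finite_simple_graph G"
    and "claw_free G"
    and "minimal_factor_critical k G"
  shows "min_degree G = k + 1"
proof -
  let ?adj = "\<lambda>x y. {x, y} \<in> edges G"
  have G: "finite (verts G)" "\<And>e. e \<in> edges G \<Longrightarrow> e \<subseteq> verts G \<and> card e = 2"
    using assms(2) unfolding finite_simple_graph_def by blast+
  have crit_G: "factor_critical k G" "\<And>e. e \<in> edges G \<Longrightarrow> \<not> factor_critical k (delete_edge G e)"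
    using assms(4) unfolding minimal_factor_critical_def by blast+
  interpret fc_graph ?adj "verts G" k
  proof
    show "?adj x y \<Longrightarrow> ?adj y x" for x y by (simp add: insert_commute)
    show "\<not> ?adj x x" for x using G(2)[of "{x, x}"] by auto
    show "?adj c x \<Longrightarrow> ?adj c y \<Longrightarrow> ?adj c z \<Longrightarrow> x \<noteq> y \<Longrightarrow> x \<noteq> z \<Longrightarrow> y \<noteq> z
        \<Longrightarrow> ?adj x y \<or> ?adj x z \<or> ?adj y z" for c x y z
      by (rule claw_free_edges[OF assms(3,2)])
    show "x \<in> verts G" if "?adj x y" for x y using G(2)[OF that] by blast
    show "pm ?adj (verts G - X)" if "X \<subseteq> verts G" "card X = k" for X
      using crit_G(1) that perfect_matching_delete_vertices_iff[OF assms(2)] unfolding factor_critical_def by blast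
  qed (use G crit_G(1) assms(1) in \<open>auto simp: factor_critical_def\<close>)
  have "critical u v" if uv: "?adj u v" for u v
  proof -
    let ?H = "delete_edge G {u, v}"
    have H: "finite_simple_graph ?H" "verts ?H = verts G" "edges ?H = edges G - {{u, v}}"
      using assms(2) unfolding finite_simple_graph_def delete_edge_def by auto
    obtain X where X: "X \<subseteq> verts G" "card X = k" "\<not> (\<exists>M. perfect_matching (delete_vertices ?H X) M)"
      using crit_G(2)[OF uv] crit_G(1) H(2) unfolding factor_critical_def by auto
    have "adj_del u v = (\<lambda>x y. {x, y} \<in> edges ?H)"
      unfolding H(3) adj_del_def by auto
    then have "\<not> pm (adj_del u v) (verts G - X)"
      using X(3) perfect_matching_delete_vertices_iff[OF H(1)] H(2) by simp
    then show ?thesis using X uv unfolding critical_def by blast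
  qed
  then obtain u where u: "u \<in> verts G" "card {y. ?adj u y} \<le> k + 1"
    using exists_degree_le by blast
  have deg: "degree G v = card {y. ?adj v y}" for v
    by (rule degree_eq_card_neighbours[OF assms(2)])
  have "degree G u = k + 1" using u degree_ge[OF u(1)] deg by (simp add: le_antisym)
  moreover have "k + 1 \<le> degree G v" if "v \<in> verts G" for v
    using degree_ge[OF that] deg by simp
  ultimately show ?thesis
    unfolding min_degree_def using u(1) G(1) by (intro Min_eqI) force+
qed

end
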